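(* Let the coefficients $(b,\sigma,f,g)$ satisfy the standing assumption (A), and assume $\sigma=\sigma(t,x,y)$ does not depend on $z$. Then, for any $T>0$, the dominating ODEs $$\overline{\mathbf y}_t=\overline h+\int_t^T\overline F(s,\overline{\mathbf y}_s)\,ds,\qquad\underline{\mathbf y}_t=\underline h+\int_t^T\underline F(s,\underline{\mathbf y}_s)\,ds$$ have bounded solutions $\overline{\mathbf y}$ and $\underline{\mathbf y}$ on $[0,T]$ if one of the following three cases holds true: (i) there exists a constant $\varepsilon>0$ such that $\sigma_2b_3\le-\varepsilon\,|b_2+f_3\sigma_2+b_3\sigma_1|$; (ii) there exist a constant $\lambda\le\underline h$ and a constant $\varepsilon>0$ small enough such that $\underline F(t,\lambda)\ge0$, $\ \sigma_2b_3\le\varepsilon\ $ and $\ b_2+f_3\sigma_2+b_3\sigma_1\le\varepsilon$; (iii) there exist a constant $\lambda\ge\overline h$ and a constant $\varepsilon>0$ small enough such that $\overline F(t,\lambda)\le0$, $\ \sigma_2b_3\le\varepsilon\ $ and $\ b_2+f_3\sigma_2+b_3\sigma_1\ge-\varepsilon$.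
   Context: Setting: $B$ is a one-dimensional standard Brownian motion on $(\Omega,\mathcal F,\mathbb P)$ with augmented natural filtration $\mathbb F$. Standing assumption (A): $b,\sigma,f:[0,T]\times\Omega\times\mathbb R^3\to\mathbb R$ are $\mathbb F$-progressively measurable for fixed $(x,y,z)$; $g:\mathbb R\times\Omega\to\mathbb R$ is $\mathcal F_T$-measurable for fixed $x$; $\mathbb E\{(\int_0^T[|b|+|f|](t,0,0,0)dt)^2+\int_0^T|\sigma|^2(t,0,0,0)dt+|g(0)|^2\}<\infty$; and $b,\sigma,f,g$ are uniformly Lipschitz in the spatial variables, uniformly in $(t,\omega)$, with common Lipschitz constant $K_0>0$. Difference quotients: for $\theta_j=(x_j,y_j,z_j)\in\mathbb R^3$, $j=1,2$, and $\varphi\in\{b,\sigma,f\}$, $$h=\tfrac{g(x_1)-g(x_2)}{x_1-x_2},\quad\varphi_1=\tfrac{\varphi(t,x_1,y_1,z_1)-\varphi(t,x_2,y_1,z_1)}{x_1-x_2},\quad\varphi_2=\tfrac{\varphi(t,x_2,y_1,z_1)-\varphi(t,x_2,y_2,z_1)}{y_1-y_2},\quad\varphi_3=\tfrac{\varphi(t,x_2,y_2,z_1)-\varphi(t,x_2,y_2,z_2)}{z_1-z_2}$$ (a quotient $\frac{\psi(x)-\psi(x)}{x-x}$ is understood as $\liminf_{\tilde x\to x}\frac{\psi(\tilde x)-\psi(x)}{\tilde x-x}$). Inequalities imposed on $b_i,\sigma_i,f_i$ are required to hold uniformly for all $\theta_1,\theta_2$ (and all $(t,\omega)$); inequalities on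 $\overline F(t,\cdot),\underline F(t,\cdot)$ are for all $t\in[0,T]$. Define $$F(\theta_1,\theta_2;t,y)=f_1+f_2y+y(b_1+b_2y)+\frac{(f_3+b_3y)y(\sigma_1+\sigma_2y)}{1-\sigma_3y}$$ (here $\sigma_3=0$, so this equals $f_1+[f_2+b_1+\sigma_1f_3]y+[b_2+f_3\sigma_2+b_3\sigma_1]y^2+\sigma_2b_3y^3$), and the deterministic quantities $$\overline h=\operatorname{esssup}\Big(\sup_{x_1\ne x_2}h\Big),\quad\underline h=\operatorname{essinf}\Big(\inf_{x_1\ne x_2}h\Big),\quad\overline F(t,y)=\operatorname{esssup}\Big(\sup F(\theta_1,\theta_2;t,y)\Big),\quad\underline F(t,y)=\operatorname{essinf}\Big(\inf F(\theta_1,\theta_2;t,y)\Big),$$ the last sup and inf over $x_1\ne x_2,y_1\neq y_2,z_1\ne z_2$, and esssup/essinf over $\omega$. *)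

theory Defs
  imports "HOL-Probability.Probability" "HOL-Probability.Essential_Supremum"
begin

definition standard_brownian_motion :: "'a measure \<Rightarrow> (real \<Rightarrow> 'a \<Rightarrow> real) \<Rightarrow> bool" where
  "standard_brownian_motion M B \<longleftrightarrow>
     prob_space M \<and>
     (\<forall>t\<ge>0. B t \<in> borel_measurable M) \<and>
     (AE \<omega> in M. B 0 \<omega> = 0) \<and>
     (AE \<omega> in M. continuous_on {0..} (\<lambda>t. B t \<omega>)) \<and>
     (\<forall>s t. 0 \<le> s \<longrightarrow> s < t \<longrightarrow>
        distributed M lborel (\<lambda>\<omega>. B t \<omega> - B s \<omega>) (normal_density 0 (sqrt (t - s)))) \<and>
     (\<forall>(n::nat) \<tau>. 0 \<le> \<tau> 0 \<longrightarrow> mono \<tau> \<longrightarrow>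
        prob_space.indep_vars M (\<lambda>_. borel) (\<lambda>i \<omega>. B (\<tau> (Suc i)) \<omega> - B (\<tau> i) \<omega>) {..<n})"

definition augmented_filtration ::
  "'a measure \<Rightarrow> (real \<Rightarrow> 'a \<Rightarrow> real) \<Rightarrow> real \<Rightarrow> 'a measure" where
  "augmented_filtration M B t =
     sigma (space M)
       ({B s -` A \<inter> space M | s A. 0 \<le> s \<and> s \<le> t \<and> A \<in> sets borel} \<union> null_sets M)"

definition prog_measurable ::
  "(real \<Rightarrow> 'a measure) \<Rightarrow> real \<Rightarrow> (real \<Rightarrow> 'a \<Rightarrow> real) \<Rightarrow> bool" where
  "prog_measurable F T X \<longleftrightarrow>
     (\<forall>t\<in>{0..T}. (\<lambda>(s, \<omega>). X s \<omega>) \<in>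
        borel_measurable (restrict_space borel {0..t} \<Otimes>\<^sub>M F t))"

type_synonym 'a coeff = "real \<Rightarrow> 'a \<Rightarrow> real \<times> real \<times> real \<Rightarrow> real"

definition standing_assumption ::
  "'a measure \<Rightarrow> (real \<Rightarrow> 'a \<Rightarrow> real) \<Rightarrow> real \<Rightarrow> real \<Rightarrow>
   'a coeff \<Rightarrow> 'a coeff \<Rightarrow> 'a coeff \<Rightarrow> (real \<Rightarrow> 'a \<Rightarrow> real) \<Rightarrow> bool" where
  "standing_assumption M B T K\<^sub>0 b \<sigma> f g \<longleftrightarrow>
     (\<forall>\<phi>\<in>{b, \<sigma>, f}. \<forall>\<theta>. prog_measurable (augmented_filtration M B) T (\<lambda>t \<omega>. \<phi> t \<omega> \<theta>)) \<and>
     (\<forall>x. g x \<in> borel_measurable (augmented_filtration M B T)) \<and>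
     (\<integral>\<^sup>+\<omega>. (\<integral>\<^sup>+t\<in>{0..T}. ennreal (\<bar>b t \<omega> (0, 0, 0)\<bar> + \<bar>f t \<omega> (0, 0, 0)\<bar>) \<partial>lborel)\<^sup>2
         + (\<integral>\<^sup>+t\<in>{0..T}. ennreal (\<bar>\<sigma> t \<omega> (0, 0, 0)\<bar>\<^sup>2) \<partial>lborel)
         + ennreal (\<bar>g 0 \<omega>\<bar>\<^sup>2) \<partial>M) < \<infinity> \<and>
     (\<forall>\<phi>\<in>{b, \<sigma>, f}. \<forall>t\<in>{0..T}. \<forall>\<omega>\<in>space M. K\<^sub>0-lipschitz_on UNIV (\<phi> t \<omega>)) \<and>
     (\<forall>\<omega>\<in>space M. K\<^sub>0-lipschitz_on UNIV (\<lambda>x. g x \<omega>))"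

definition diff_quot :: "(real \<Rightarrow> real) \<Rightarrow> real \<Rightarrow> real \<Rightarrow> real" where
  "diff_quot \<psi> u v =
     (if u = v then real_of_ereal (Liminf (at v) (\<lambda>w. ereal ((\<psi> w - \<psi> v) / (w - v))))
      else (\<psi> u - \<psi> v) / (u - v))"

fun dq1 :: "(real \<times> real \<times> real \<Rightarrow> real) \<Rightarrow> real \<times> real \<times> real \<Rightarrow> real \<times> real \<times> real \<Rightarrow> real" where
  "dq1 \<phi> (x1, y1, z1) (x2, y2, z2) = diff_quot (\<lambda>x. \<phi> (x, y1, z1)) x1 x2"

fun dq2 :: "(real \<times> real \<times> real \<Rightarrow> real) \<Rightarrow> real \<times> real \<times> real \<Rightarrow> real \<times> real \<times> real \<Rightarrow> real" where
  "dq2 \<phi> (x1, y1, z1) (x2, y2, z2) = diff_quot (\<lambda>y. \<phi> (x2, y, z1)) y1 y2"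

fun dq3 :: "(real \<times> real \<times> real \<Rightarrow> real) \<Rightarrow> real \<times> real \<times> real \<Rightarrow> real \<times> real \<times> real \<Rightarrow> real" where
  "dq3 \<phi> (x1, y1, z1) (x2, y2, z2) = diff_quot (\<lambda>z. \<phi> (x2, y2, z)) z1 z2"

definition char_F ::
  "'a coeff \<Rightarrow> 'a coeff \<Rightarrow> 'a coeff \<Rightarrow> real \<Rightarrow> 'a \<Rightarrow>
   real \<times> real \<times> real \<Rightarrow> real \<times> real \<times> real \<Rightarrow> real \<Rightarrow> real" where
  "char_F b \<sigma> f t \<omega> \<theta>1 \<theta>2 y =
     (let b1 = dq1 (b t \<omega>) \<theta>1 \<theta>2; b2 = dq2 (b t \<omega>) \<theta>1 \<theta>2; b3 = dq3 (b t \<omega>) \<theta>1 \<theta>2;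
          \<sigma>1 = dq1 (\<sigma> t \<omega>) \<theta>1 \<theta>2; \<sigma>2 = dq2 (\<sigma> t \<omega>) \<theta>1 \<theta>2; \<sigma>3 = dq3 (\<sigma> t \<omega>) \<theta>1 \<theta>2;
          f1 = dq1 (f t \<omega>) \<theta>1 \<theta>2; f2 = dq2 (f t \<omega>) \<theta>1 \<theta>2; f3 = dq3 (f t \<omega>) \<theta>1 \<theta>2
      in f1 + f2 * y + y * (b1 + b2 * y)
         + (f3 + b3 * y) * y * (\<sigma>1 + \<sigma>2 * y) / (1 - \<sigma>3 * y))"

definition quad_coeff ::
  "'a coeff \<Rightarrow> 'a coeff \<Rightarrow> 'a coeff \<Rightarrow> real \<Rightarrow> 'a \<Rightarrow>
   real \<times> real \<times> real \<Rightarrow> real \<times> real \<times> real \<Rightarrow> real" where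
  "quad_coeff b \<sigma> f t \<omega> \<theta>1 \<theta>2 =
     dq2 (b t \<omega>) \<theta>1 \<theta>2 + dq3 (f t \<omega>) \<theta>1 \<theta>2 * dq2 (\<sigma> t \<omega>) \<theta>1 \<theta>2
       + dq3 (b t \<omega>) \<theta>1 \<theta>2 * dq1 (\<sigma> t \<omega>) \<theta>1 \<theta>2"

definition cubic_coeff ::
  "'a coeff \<Rightarrow> 'a coeff \<Rightarrow> real \<Rightarrow> 'a \<Rightarrow>
   real \<times> real \<times> real \<Rightarrow> real \<times> real \<times> real \<Rightarrow> real" where
  "cubic_coeff b \<sigma> t \<omega> \<theta>1 \<theta>2 = dq2 (\<sigma> t \<omega>) \<theta>1 \<theta>2 * dq3 (b t \<omega>) \<theta>1 \<theta>2"

definition essinf :: "'a measure \<Rightarrow> ('a \<Rightarrow> ereal) \<Rightarrow> ereal" where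
  "essinf M X = - esssup M (\<lambda>\<omega>. - X \<omega>)"

definition off_diag :: "((real \<times> real \<times> real) \<times> (real \<times> real \<times> real)) set" where
  "off_diag = {((x1, y1, z1), (x2, y2, z2)) | x1 y1 z1 x2 y2 z2. x1 \<noteq> x2 \<and> y1 \<noteq> y2 \<and> z1 \<noteq> z2}"

(* The following suprema and infima are taken in the extended reals.  Under the
   standing assumption, with the third argument absent from \<sigma>, they are finite,
   so that real_of_ereal loses nothing. *)

definition h_upper :: "'a measure \<Rightarrow> (real \<Rightarrow> 'a \<Rightarrow> real) \<Rightarrow> real" where
  "h_upper M g = real_of_ereal (esssup M (\<lambda>\<omega>.
     SUP (x1, x2)\<in>{(x1, x2). x1 \<noteq> x2}. ereal (diff_quot (\<lambda>x. g x \<omega>) x1 x2)))"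

definition h_lower :: "'a measure \<Rightarrow> (real \<Rightarrow> 'a \<Rightarrow> real) \<Rightarrow> real" where
  "h_lower M g = real_of_ereal (essinf M (\<lambda>\<omega>.
     INF (x1, x2)\<in>{(x1, x2). x1 \<noteq> x2}. ereal (diff_quot (\<lambda>x. g x \<omega>) x1 x2)))"

definition F_upper ::
  "'a measure \<Rightarrow> 'a coeff \<Rightarrow> 'a coeff \<Rightarrow> 'a coeff \<Rightarrow> real \<Rightarrow> real \<Rightarrow> real" where
  "F_upper M b \<sigma> f t y = real_of_ereal (esssup M (\<lambda>\<omega>.
     SUP (\<theta>1, \<theta>2)\<in>off_diag. ereal (char_F b \<sigma> f t \<omega> \<theta>1 \<theta>2 y)))"

definition F_lower ::
  "'a measure \<Rightarrow> 'a coeff \<Rightarrow> 'a coeff \<Rightarrow> 'a coeff \<Rightarrow> real \<Rightarrow> real \<Rightarrow> real" where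
  "F_lower M b \<sigma> f t y = real_of_ereal (essinf M (\<lambda>\<omega>.
     INF (\<theta>1, \<theta>2)\<in>off_diag. ereal (char_F b \<sigma> f t \<omega> \<theta>1 \<theta>2 y)))"

definition bounded_backward_solution ::
  "real \<Rightarrow> real \<Rightarrow> (real \<Rightarrow> real \<Rightarrow> real) \<Rightarrow> (real \<Rightarrow> real) \<Rightarrow> bool" where
  "bounded_backward_solution T h G y \<longleftrightarrow>
     bounded (y ` {0..T}) \<and>
     set_integrable lborel {0..T} (\<lambda>s. G s (y s)) \<and>
     (\<forall>t\<in>{0..T}. y t = h + (LINT s:{t..T}|lborel. G s (y s)))"

definition case_i ::
  "'a measure \<Rightarrow> real \<Rightarrow> 'a coeff \<Rightarrow> 'a coeff \<Rightarrow> 'a coeff \<Rightarrow> bool" where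
  "case_i M T b \<sigma> f \<longleftrightarrow>
     (\<exists>\<epsilon>>0. \<forall>t\<in>{0..T}. \<forall>\<omega>\<in>space M. \<forall>\<theta>1 \<theta>2.
        cubic_coeff b \<sigma> t \<omega> \<theta>1 \<theta>2 \<le> - \<epsilon> * \<bar>quad_coeff b \<sigma> f t \<omega> \<theta>1 \<theta>2\<bar>)"

definition case_ii ::
  "'a measure \<Rightarrow> real \<Rightarrow> 'a coeff \<Rightarrow> 'a coeff \<Rightarrow> 'a coeff \<Rightarrow> (real \<Rightarrow> 'a \<Rightarrow> real) \<Rightarrow> real \<Rightarrow> bool" where
  "case_ii M T b \<sigma> f g \<epsilon> \<longleftrightarrow>
     (\<exists>l. l \<le> h_lower M g \<and> (\<forall>t\<in>{0..T}. F_lower M b \<sigma> f t l \<ge> 0)) \<and>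
     (\<forall>t\<in>{0..T}. \<forall>\<omega>\<in>space M. \<forall>\<theta>1 \<theta>2.
        cubic_coeff b \<sigma> t \<omega> \<theta>1 \<theta>2 \<le> \<epsilon> \<and> quad_coeff b \<sigma> f t \<omega> \<theta>1 \<theta>2 \<le> \<epsilon>)"

definition case_iii ::
  "'a measure \<Rightarrow> real \<Rightarrow> 'a coeff \<Rightarrow> 'a coeff \<Rightarrow> 'a coeff \<Rightarrow> (real \<Rightarrow> 'a \<Rightarrow> real) \<Rightarrow> real \<Rightarrow> bool" where
  "case_iii M T b \<sigma> f g \<epsilon> \<longleftrightarrow>
     (\<exists>l. l \<ge> h_upper M g \<and> (\<forall>t\<in>{0..T}. F_upper M b \<sigma> f t l \<le> 0)) \<and>
     (\<forall>t\<in>{0..T}. \<forall>\<omega>\<in>space M. \<forall>\<theta>1 \<theta>2.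
        cubic_coeff b \<sigma> t \<omega> \<theta>1 \<theta>2 \<le> \<epsilon> \<and> quad_coeff b \<sigma> f t \<omega> \<theta>1 \<theta>2 \<ge> - \<epsilon>)"

end

theory Submission
  imports Defs
begin

text \<open>Off the diagonal and with \<open>\<sigma>\<close> free of \<open>z\<close>, the driver is a cubic polynomial in \<open>y\<close> whose
  coefficients are bounded in terms of the Lipschitz constant. Hence the essential bounds
  \<open>F_upper\<close> and \<open>F_lower\<close> are locally Lipschitz in \<open>y\<close>; they are measurable in \<open>t\<close> since, by continuity,
  the suprema may be taken over a countable dense set of \<open>\<theta>\<close>. So both equations have solutions
  as long as these are kept between a subsolution and a supersolution. Writing \<open>C\<close> for the bound
  on the linear coefficient, the barriers are \<open>R exp (3 C (T - t))\<close> from above and its negative from below: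
  in case (i) the cubic term beats the quadratic one once \<open>R \<ge> 1 / \<epsilon>\<close>, and in cases (ii) and (iii)
  the exponential bounds one side when \<open>\<epsilon>\<close> is small, while the constant \<open>\<lambda>\<close> bounds the other.\<close>

section \<open>Backward equations between barriers\<close>

text \<open>Rounding \<open>w\<close> down to multiples of \<open>1 / real (Suc n)\<close> leaves
  countably many states, so measurability in \<open>s\<close> for each fixed state suffices;
  continuity of \<open>H s\<close> carries it over to the limit.\<close>

lemma borel_measurable_caratheodory_compose:
  fixes H :: "'b \<Rightarrow> real \<Rightarrow> real"
  assumes H: "\<And>y. (\<lambda>s. H s y) \<in> borel_measurable N"
    and cont: "\<And>s. s \<in> space N \<Longrightarrow> continuous_on UNIV (H s)"
    and [measurable]: "w \<in> borel_measurable N"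
  shows "(\<lambda>s. H s (w s)) \<in> borel_measurable N"
proof (rule borel_measurable_LIMSEQ_real)
  let ?a = "\<lambda>(n::nat) s. of_int \<lfloor>real (Suc n) * w s\<rfloor> / real (Suc n)"
  show "(\<lambda>s. H s (?a n s)) \<in> borel_measurable N" for n
    by (rule measurable_compose_countable
        [where f = "\<lambda>i s. H s (of_int i / real (Suc n))" and g = "\<lambda>s. \<lfloor>real (Suc n) * w s\<rfloor>"])
      (use H in measurable)
  show "(\<lambda>n. H s (?a n s)) \<longlonglongrightarrow> H s (w s)" if "s \<in> space N" for s
  proof -
    have "(\<lambda>n. ?a n s) \<longlonglongrightarrow> w s"
    proof (rule LIMSEQ_I)
      fix r :: real assume "r > 0"
      then obtain n0 where n0: "inverse (real (Suc n0)) < r"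
        using reals_Archimedean by blast
      show "\<exists>n0. \<forall>n\<ge>n0. norm (?a n s - w s) < r"
      proof (intro exI allI impI)
        fix n assume "n \<ge> n0"
        have "\<bar>?a n s - w s\<bar> = \<bar>of_int \<lfloor>real (Suc n) * w s\<rfloor> - real (Suc n) * w s\<bar> / real (Suc n)"
          by (subst abs_div_pos) (simp_all add: diff_divide_distrib)
        also have "\<dots> \<le> 1 / real (Suc n)"
          by (intro divide_right_mono) (simp, linarith, simp)
        also have "\<dots> = inverse (real (Suc n))"
          by (simp add: inverse_eq_divide)
        also have "\<dots> \<le> inverse (real (Suc n0))"
          using \<open>n \<ge> n0\<close> by (simp add: field_simps)
        finally show "norm (?a n s - w s) < r"
          using n0 by simp
      qed
    qed
    then show ?thesis
      using cont[OF that] by (auto intro: continuous_on_tendsto_compose)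
  qed
qed

lemma set_integrable_bounded_interval:
  fixes k :: "real \<Rightarrow> real"
  assumes meas: "k \<in> borel_measurable (restrict_space borel {a..b})"
    and bd: "\<And>s. s \<in> {a..b} \<Longrightarrow> \<bar>k s\<bar> \<le> C"
  shows "set_integrable lborel {a..b} k"
  unfolding set_integrable_def
proof (rule Bochner_Integration.integrable_bound)
  show "integrable lborel (\<lambda>s. indicator {a..b} s * C)"
    by (intro integrable_mult_left integrable_real_indicator)
      (auto simp: emeasure_lborel_Icc_eq)
  show "(\<lambda>s. indicator {a..b} s *\<^sub>R k s) \<in> borel_measurable lborel"
    using meas by (subst (asm) borel_measurable_restrict_space_iff) (auto simp: mult.commute)
  show "AE s in lborel. norm (indicator {a..b} s *\<^sub>R k s) \<le> norm (indicator {a..b} s * C)"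
    using order_trans[OF bd abs_ge_self] by (intro AE_I2) (auto simp: indicator_def)
qed

text \<open>If \<open>u\<close> exceeded \<open>v\<close> at \<open>t\<close>, there would be a
  first later time \<open>c\<close> at which the two meet, because of the terminal order. On
  \<open>{t..c}\<close> the inequality \<open>v \<le> u\<close> makes \<open>p \<le> q\<close>, and
  integrating backward from \<open>c\<close> gives \<open>u t \<le> v t\<close> after all. The
  drivers need to be ordered only where \<open>u\<close> is on top, which is exactly what clamping
  provides later.\<close>

lemma backward_comparison:
  fixes u v p q :: "real \<Rightarrow> real"
  assumes cont: "continuous_on {0..T} u" "continuous_on {0..T} v"
    and u: "\<And>r t. 0 \<le> r \<Longrightarrow> r \<le> t \<Longrightarrow> t \<le> T \<Longrightarrow> (p has_integral u r - u t) {r..t}"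
    and v: "\<And>r t. 0 \<le> r \<Longrightarrow> r \<le> t \<Longrightarrow> t \<le> T \<Longrightarrow> (q has_integral v r - v t) {r..t}"
    and le: "\<And>s. s \<in> {0..T} \<Longrightarrow> v s \<le> u s \<Longrightarrow> p s \<le> q s"
    and terminal: "u T \<le> v T"
    and t: "t \<in> {0..T}"
  shows "u t \<le> v t"
proof (rule ccontr)
  assume "\<not> u t \<le> v t"
  let ?D = "\<lambda>s. u s - v s"
  have D: "continuous_on {0..T} ?D"
    using cont by (intro continuous_intros)
  define Z where "Z = {t..T} \<inter> ?D -` {0}"
  have "closed Z"
    unfolding Z_def using D t
    by (intro continuous_closed_preimage continuous_on_subset[OF D]) auto
  then have "compact Z"
    unfolding Z_def by (metis Int_assoc Int_absorb compact_Icc compact_Int_closed)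
  \<comment> \<open>The difference is positive at \<open>t\<close>, so it vanishes somewhere before
    any time at which it is nonpositive. This is used twice: at \<open>T\<close>, to see that the
    functions meet at all, and before \<open>c\<close>, to exclude an earlier sign change.\<close>
  moreover have zero: "\<exists>z. t \<le> z \<and> z \<le> s \<and> ?D z = 0" if "s \<in> {t..T}" "?D s \<le> 0" for s
    using that t \<open>\<not> u t \<le> v t\<close> by (intro IVT2' continuous_on_subset[OF D]) auto
  then have "Z \<noteq> {}"
    using zero[of T] t terminal by (force simp: Z_def)
  ultimately obtain c where c: "c \<in> Z" and c_min: "\<And>z. z \<in> Z \<Longrightarrow> c \<le> z"
    using compact_attains_inf[of Z] by blast
  have "v s \<le> u s" if s: "s \<in> {t..c}" for s
  proof (rule ccontr)
    assume "\<not> v s \<le> u s"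
    then obtain z where z: "t \<le> z" "z \<le> s" "?D z = 0"
      using zero[of s] s c by (force simp: Z_def)
    then have "c \<le> z"
      using c s by (intro c_min) (auto simp: Z_def)
    then have "z = s"
      using s z by simp
    then show False
      using z \<open>\<not> v s \<le> u s\<close> by simp
  qed
  then have "u t - u c \<le> v t - v c"
    using t c by (intro has_integral_le[OF u v] le) (auto simp: Z_def)
  then show False
    using c \<open>\<not> u t \<le> v t\<close> by (auto simp: Z_def)
qed

lemma backward_picard:
  fixes H :: "real \<Rightarrow> real \<Rightarrow> real"
  assumes T: "0 \<le> T"
    and meas: "\<And>w. continuous_on {0..T} w \<Longrightarrow>
      (\<lambda>s. H s (w s)) \<in> borel_measurable (restrict_space borel {0..T})"
    and bd: "\<And>s y. s \<in> {0..T} \<Longrightarrow> \<bar>H s y\<bar> \<le> C"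
    and lip: "\<And>s y y'. s \<in> {0..T} \<Longrightarrow> \<bar>H s y - H s y'\<bar> \<le> L * \<bar>y - y'\<bar>"
    and L: "L > 0"
  obtains y where "continuous_on {0..T} y"
    and "\<And>t. t \<in> {0..T} \<Longrightarrow> y t = h + integral {t..T} (\<lambda>s. H s (y s))"
proof -
  \<comment> \<open>In the norm weighted by \<open>1 / e\<close> the Picard map is a contraction on all of \<open>[0, T]\<close> at once.\<close>
  define e where "e = (\<lambda>s. exp (2 * L * (T - s)))"
  have e_pos: "e s > 0" for s
    by (simp add: e_def)
  have e_cont: "continuous_on S e" for S
    unfolding e_def by (intro continuous_intros)
  let ?k = "\<lambda>z s. H s (e s * apply_bcontfun z s)"
  \<comment> \<open>The unknown is the rescaled function \<open>z = y / e\<close>, for which the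
    weighted norm of \<open>y\<close> becomes the plain sup norm; \<open>P z\<close> is the rescaled
    Picard iterate.\<close>
  define P where "P z t = (h + integral {t..T} (?k z)) / e t" for z t
  have int0: "?k z integrable_on {0..T}" for z
    by (rule set_borel_integral_eq_integral(1)
        [OF set_integrable_bounded_interval[OF meas bd]])
      (auto intro!: continuous_intros e_cont)
  then have int: "?k z integrable_on {t..T}" if "t \<in> {0..T}" for z t
    using that by (intro integrable_subinterval_real[OF int0]) auto
  have P_cont: "continuous_on {0..T} (P z)" for z
    unfolding P_def using e_pos
    by (intro continuous_intros e_cont indefinite_integral_continuous_1' int0) (auto simp: less_imp_neq[symmetric])
  \<comment> \<open>The complete space for Banach's theorem consists of bounded continuous functions
    on the whole line, so each iterate is extended by its end values outside
    \<open>{0..T}\<close>.\<close>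
  have "\<exists>\<Psi>. \<forall>z t. apply_bcontfun (\<Psi> z) t = P z (clamp 0 T t)"
  proof (rule choice, rule)
    show "\<exists>w. \<forall>t. apply_bcontfun w t = P z (clamp 0 T t)" for z
      using continuous_on_cbox_bcontfunE[of 0 T "P z"] P_cont by (metis cbox_interval)
  qed
  then obtain \<Psi> where \<Psi>: "\<And>z t. apply_bcontfun (\<Psi> z) t = P z (clamp 0 T t)"
    by blast
  have clamp: "clamp 0 T t \<in> {0..T}" for t
    using clamp_in_interval[of 0 T t] T by simp
  \<comment> \<open>The exponent \<open>2 * L\<close> makes this integral at most
    \<open>e t / (2 * L)\<close>: multiplied by the Lipschitz constant and divided by the weight, it
    leaves the contraction factor 1/2.\<close>
  have e_int: "(e has_integral (e t - 1) / (2 * L)) {t..T}" if "t \<in> {0..T}" for t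
  proof -
    have "(e has_integral - (e T / (2 * L)) - - (e t / (2 * L))) {t..T}"
    proof (rule fundamental_theorem_of_calculus)
      show "((\<lambda>s. - (e s / (2 * L))) has_vector_derivative e s) (at s within {t..T})" for s
        unfolding e_def has_real_derivative_iff_has_vector_derivative[symmetric]
        using L by (auto intro!: derivative_eq_intros)
    qed (use that in auto)
    then show ?thesis
      using L by (simp add: e_def diff_divide_distrib)
  qed
  have "dist (\<Psi> z) (\<Psi> z') \<le> 1/2 * dist z z'" for z z'
  proof (rule dist_bound)
    fix x
    define t where "t = clamp 0 T x"
    then have t: "t \<in> {0..T}"
      using clamp by simp
    have "\<bar>integral {t..T} (?k z) - integral {t..T} (?k z')\<bar>
        = \<bar>integral {t..T} (\<lambda>s. ?k z s - ?k z' s)\<bar>"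
      using int t by (subst integral_diff) auto
    also have "\<dots> \<le> integral {t..T} (\<lambda>s. e s * (L * dist z z'))"
    proof (rule integral_norm_bound_integral[where 'a = real, unfolded real_norm_def])
      show "(\<lambda>s. ?k z s - ?k z' s) integrable_on {t..T}"
        using int t by (intro integrable_diff) auto
      show "(\<lambda>s. e s * (L * dist z z')) integrable_on {t..T}"
        by (intro integrable_continuous_real continuous_intros e_cont)
      fix s assume "s \<in> {t..T}"
      with t have "\<bar>?k z s - ?k z' s\<bar> \<le> L * \<bar>e s * z s - e s * z' s\<bar>"
        by (intro lip) auto
      also have "\<dots> = L * (e s * dist (z s) (z' s))"
        using e_pos[of s] by (simp add: dist_real_def abs_mult flip: right_diff_distrib)
      also have "\<dots> \<le> L * (e s * dist z z')"
        using L e_pos[of s] by (intro mult_left_mono dist_bounded) auto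
      finally show "\<bar>?k z s - ?k z' s\<bar> \<le> e s * (L * dist z z')"
        by (simp add: ac_simps)
    qed
    also have "\<dots> = (e t - 1) / (2 * L) * (L * dist z z')"
      using has_integral_mult_left[OF e_int[OF t]] by (rule integral_unique)
    also have "\<dots> \<le> e t / (2 * L) * (L * dist z z')"
      using L by (intro mult_right_mono divide_right_mono) auto
    also have "\<dots> = (1/2 * dist z z') * e t"
      using L by simp
    finally show "dist (\<Psi> z x) (\<Psi> z' x) \<le> 1/2 * dist z z'"
      using e_pos[of t]
      by (simp add: \<Psi> P_def dist_real_def t_def[symmetric] divide_le_eq flip: diff_divide_distrib)
  qed
  then obtain z where z: "\<Psi> z = z"
    using banach_fix_type[of "1/2" \<Psi>] by auto
  define y where "y t = e t * z t" for t
  show ?thesis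
  proof
    show "continuous_on {0..T} y"
      unfolding y_def by (intro continuous_intros e_cont) simp
    fix t assume t: "t \<in> {0..T}"
    have "z t = P z t"
      using t \<Psi>[of z t] by (simp add: z)
    then show "y t = h + integral {t..T} (\<lambda>s. H s (y s))"
      using e_pos[of t] by (simp add: y_def P_def)
  qed
qed

text \<open>A locally Lipschitz driver may blow up in finite time; the barriers confine the solution
  to a bounded strip, where one Lipschitz constant serves. The signs in \<open>sub\<close> and
  \<open>super\<close> come from the differential form \<open>y' = - G s y\<close> of the backward
  equation.\<close>

lemma backward_solution_between_barriers:
  fixes G :: "real \<Rightarrow> real \<Rightarrow> real"
  assumes T: "0 \<le> T"
    and meas: "\<And>y. (\<lambda>s. G s y) \<in> borel_measurable (restrict_space borel {0..T})"
    and lip: "\<And>R. \<exists>L. \<forall>s\<in>{0..T}. \<forall>y y'. \<bar>y\<bar> \<le> R \<longrightarrow> \<bar>y'\<bar> \<le> R \<longrightarrow>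
      \<bar>G s y - G s y'\<bar> \<le> L * \<bar>y - y'\<bar>"
    and bd: "\<And>s. s \<in> {0..T} \<Longrightarrow> \<bar>G s 0\<bar> \<le> C"
    and \<alpha>: "\<And>s. s \<in> {0..T} \<Longrightarrow> (\<alpha> has_real_derivative \<alpha>' s) (at s within {0..T})"
    and \<beta>: "\<And>s. s \<in> {0..T} \<Longrightarrow> (\<beta> has_real_derivative \<beta>' s) (at s within {0..T})"
    and \<alpha>\<beta>: "\<And>s. s \<in> {0..T} \<Longrightarrow> \<alpha> s \<le> \<beta> s"
    and sub: "\<And>s. s \<in> {0..T} \<Longrightarrow> - \<alpha>' s \<le> G s (\<alpha> s)"
    and super: "\<And>s. s \<in> {0..T} \<Longrightarrow> G s (\<beta> s) \<le> - \<beta>' s"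
    and terminal: "\<alpha> T \<le> h" "h \<le> \<beta> T"
  shows "\<exists>y. bounded_backward_solution T h G y"
proof -
  have cont: "continuous_on {0..T} \<alpha>" "continuous_on {0..T} \<beta>"
    using DERIV_continuous_on[OF \<alpha>] DERIV_continuous_on[OF \<beta>] by blast+
  then have "bounded (\<alpha> ` {0..T} \<union> \<beta> ` {0..T})"
    by (simp add: compact_imp_bounded compact_continuous_image)
  then obtain R where R: "\<And>s. s \<in> {0..T} \<Longrightarrow> \<bar>\<alpha> s\<bar> \<le> R" "\<And>s. s \<in> {0..T} \<Longrightarrow> \<bar>\<beta> s\<bar> \<le> R"
    unfolding bounded_iff by fastforce
  then have R0: "R \<ge> 0"
    using T by (meson abs_ge_zero atLeastAtMost_iff order_refl order_trans)
  obtain L0 where L0: "\<And>s y y'. s \<in> {0..T} \<Longrightarrow> \<bar>y\<bar> \<le> R \<Longrightarrow> \<bar>y'\<bar> \<le> R \<Longrightarrow>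
      \<bar>G s y - G s y'\<bar> \<le> L0 * \<bar>y - y'\<bar>"
    using lip[of R] by blast
  \<comment> \<open>The maximum with 1 supplies the strict positivity that
    \<open>backward_picard\<close> asks for.\<close>
  define L where "L = max L0 1"
  have L: "\<bar>G s y - G s y'\<bar> \<le> L * \<bar>y - y'\<bar>" if "s \<in> {0..T}" "\<bar>y\<bar> \<le> R" "\<bar>y'\<bar> \<le> R" for s y y'
    using L0[OF that] mult_right_mono[of L0 L "\<bar>y - y'\<bar>"] by (simp add: L_def)
  \<comment> \<open>Solve the equation with the state clamped between the barriers: where the solution exceeds \<open>\<beta>\<close>,
    the clamped driver is \<open>G s (\<beta> s)\<close>, so it cannot have left the strip.\<close>
  define c where "c s y = max (\<alpha> s) (min y (\<beta> s))" for s y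
  have c_le: "\<bar>c s y\<bar> \<le> R" if "s \<in> {0..T}" for s y
    using R[OF that] by (auto simp: c_def abs_le_iff)
  have c_lip: "\<bar>c s y - c s y'\<bar> \<le> \<bar>y - y'\<bar>" for s y y'
    by (auto simp: c_def max_def min_def)
  have G_cont: "continuous_on UNIV (G s)" if s: "s \<in> {0..T}" for s
    unfolding continuous_on_eq_continuous_at[OF open_UNIV]
  proof
    fix x
    obtain L' where L': "\<And>y y'. \<bar>y\<bar> \<le> \<bar>x\<bar> + 1 \<Longrightarrow> \<bar>y'\<bar> \<le> \<bar>x\<bar> + 1 \<Longrightarrow> \<bar>G s y - G s y'\<bar> \<le> L' * \<bar>y - y'\<bar>"
      using lip[of "\<bar>x\<bar> + 1"] s by blast
    \<comment> \<open>Nothing is known about the sign of \<open>L'\<close>, whereas a Lipschitz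
      constant must be nonnegative.\<close>
    have "\<bar>L'\<bar>-lipschitz_on {x - 1<..<x + 1} (G s)"
    proof (rule lipschitz_onI)
      fix y y' assume "y \<in> {x - 1<..<x + 1}" "y' \<in> {x - 1<..<x + 1}"
      then have "\<bar>G s y - G s y'\<bar> \<le> L' * \<bar>y - y'\<bar>"
        by (intro L') auto
      also have "\<dots> \<le> \<bar>L'\<bar> * \<bar>y - y'\<bar>"
        by (intro mult_right_mono) auto
      finally show "dist (G s y) (G s y') \<le> \<bar>L'\<bar> * dist y y'"
        by (simp add: dist_real_def)
    qed simp
    then have "continuous_on {x - 1<..<x + 1} (G s)"
      by (rule lipschitz_on_continuous_on)
    then show "isCont (G s) x"
      by (rule continuous_on_interior) auto
  qed
  have G_meas: "(\<lambda>s. G s (w s)) \<in> borel_measurable (restrict_space borel {0..T})"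
    if "continuous_on {0..T} w" for w
    by (rule borel_measurable_caratheodory_compose[OF meas G_cont
          borel_measurable_continuous_on_restrict[OF that]])
      (simp add: space_restrict_space)
  have G_bd: "\<bar>G s (c s y)\<bar> \<le> C + L * R" if "s \<in> {0..T}" for s y
  proof -
    have "\<bar>G s (c s y) - G s 0\<bar> \<le> L * \<bar>c s y\<bar>"
      using L[OF that c_le[OF that], of 0 y] R0 by simp
    also have "\<dots> \<le> L * R"
      using c_le[OF that] by (intro mult_left_mono) (auto simp: L_def)
    finally show ?thesis
      using bd[OF that] by linarith
  qed
  obtain y where y_cont: "continuous_on {0..T} y"
    and y: "\<And>t. t \<in> {0..T} \<Longrightarrow> y t = h + integral {t..T} (\<lambda>s. G s (c s (y s)))"
  proof (rule backward_picard[of T "\<lambda>s y. G s (c s y)" "C + L * R" L h])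
    show "\<bar>G s (c s y) - G s (c s y')\<bar> \<le> L * \<bar>y - y'\<bar>" if "s \<in> {0..T}" for s y y'
    proof -
      have "\<bar>G s (c s y) - G s (c s y')\<bar> \<le> L * \<bar>c s y - c s y'\<bar>"
        using that by (intro L c_le)
      also have "\<dots> \<le> L * \<bar>y - y'\<bar>"
        using c_lip by (intro mult_left_mono) (auto simp: L_def)
      finally show ?thesis .
    qed
    show "(\<lambda>s. G s (c s (w s))) \<in> borel_measurable (restrict_space borel {0..T})"
      if "continuous_on {0..T} w" for w
      unfolding c_def using that cont by (intro G_meas continuous_intros)
  qed (use T G_bd in \<open>auto simp: L_def\<close>)
  let ?p = "\<lambda>s. G s (c s (y s))"
  have p_int: "set_integrable lborel {0..T} ?p"
    using y_cont cont G_bd unfolding c_def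
    by (intro set_integrable_bounded_interval G_meas continuous_intros) auto
  then have p_int': "?p integrable_on {r..t}" if "0 \<le> r" "t \<le> T" for r t
    using that set_borel_integral_eq_integral(1)[OF p_int] integrable_subinterval_real[of ?p 0 T r t]
    by (auto simp: subset_iff)
  have y_int: "(?p has_integral y r - y t) {r..t}" if "0 \<le> r" "r \<le> t" "t \<le> T" for r t
  proof -
    have "integral {r..t} ?p + integral {t..T} ?p = integral {r..T} ?p"
      using that by (intro Henstock_Kurzweil_Integration.integral_combine p_int') auto
    then have "y r - y t = integral {r..t} ?p"
      using y[of r] y[of t] that by simp
    then show ?thesis
      using p_int'[of r t] that by (simp add: integrable_integral)
  qed
  have barrier_int: "((\<lambda>s. - \<gamma>' s) has_integral \<gamma> r - \<gamma> t) {r..t}"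
    if "\<And>s. s \<in> {0..T} \<Longrightarrow> (\<gamma> has_real_derivative \<gamma>' s) (at s within {0..T})"
      and "0 \<le> r" "r \<le> t" "t \<le> T" for \<gamma> \<gamma>' :: "real \<Rightarrow> real" and r t
  proof -
    have "(\<gamma>' has_integral \<gamma> t - \<gamma> r) {r..t}"
      using that by (intro fundamental_theorem_of_calculus)
        (auto simp: has_real_derivative_iff_has_vector_derivative[symmetric] intro!: DERIV_subset[OF that(1)])
    then show ?thesis
      by (auto dest: has_integral_neg)
  qed
  have yT: "y T = h"
    using y[of T] T by simp
  have upper: "y s \<le> \<beta> s" if "s \<in> {0..T}" for s
  proof (rule backward_comparison[OF y_cont cont(2) y_int barrier_int[OF \<beta>] _ _ that])
    show "?p s \<le> - \<beta>' s" if "s \<in> {0..T}" "\<beta> s \<le> y s" for s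
      using that super[of s] \<alpha>\<beta>[of s] by (simp add: c_def min_absorb2 max_absorb2)
  qed (use terminal yT in auto)
  have lower: "\<alpha> s \<le> y s" if "s \<in> {0..T}" for s
  proof (rule backward_comparison[OF cont(1) y_cont barrier_int[OF \<alpha>] y_int _ _ that])
    show "- \<alpha>' s \<le> ?p s" if "s \<in> {0..T}" "y s \<le> \<alpha> s" for s
      using that sub[of s] by (simp add: c_def min.coboundedI1 max_absorb1)
  qed (use terminal yT in auto)
  have p_eq: "?p s = G s (y s)" if "s \<in> {0..T}" for s
    using upper[OF that] lower[OF that] by (simp add: c_def)
  have G_int: "set_integrable lborel {0..T} (\<lambda>s. G s (y s))"
    using p_int p_eq by (subst set_integrable_cong[OF refl refl]) auto
  have "y t = h + (LINT s:{t..T}|lborel. G s (y s))" if t: "t \<in> {0..T}" for t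
  proof -
    have "set_integrable lborel {t..T} (\<lambda>s. G s (y s))"
      using t by (intro set_integrable_subset[OF G_int]) auto
    then have "(LINT s:{t..T}|lborel. G s (y s)) = integral {t..T} (\<lambda>s. G s (y s))"
      by (rule set_borel_integral_eq_integral)
    also have "\<dots> = integral {t..T} ?p"
      using t p_eq by (intro integral_cong) auto
    finally show ?thesis
      using y[OF t] by simp
  qed
  moreover have "bounded (y ` {0..T})"
    using y_cont by (simp add: compact_imp_bounded compact_continuous_image)
  ultimately show ?thesis
    using G_int unfolding bounded_backward_solution_def by blast
qed

section \<open>Essential suprema of continuous random fields\<close>

lemma continuous_on_le_dense:
  fixes \<phi> :: "'i::metric_space \<Rightarrow> real"
  assumes "continuous_on I \<phi>" "D \<subseteq> I" "I \<subseteq> closure D" "\<And>d. d \<in> D \<Longrightarrow> \<phi> d \<le> c" "i \<in> I"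
  shows "\<phi> i \<le> c"
proof -
  obtain x where x: "\<And>n. x n \<in> D" "x \<longlonglongrightarrow> i"
    using assms closure_sequential[of i D] by blast
  then have "(\<lambda>n. \<phi> (x n)) \<longlonglongrightarrow> \<phi> i"
    using assms(2,5) by (intro continuous_on_tendsto_compose[OF assms(1)]) (auto intro!: always_eventually)
  then show ?thesis
    using x assms(4) by (intro LIMSEQ_le_const2) auto
qed

text \<open>The common shape of \<open>h_upper\<close> and \<open>F_upper\<close>, with pairs of
  arguments collected into an index \<open>i\<close>; \<open>ess_Inf\<close> plays the same part for
  the lower quantities.\<close>

definition ess_Sup :: "'a measure \<Rightarrow> 'i set \<Rightarrow> ('a \<Rightarrow> 'i \<Rightarrow> real) \<Rightarrow> real" where
  "ess_Sup M I \<Phi> = real_of_ereal (esssup M (\<lambda>\<omega>. SUP i\<in>I. ereal (\<Phi> \<omega> i)))"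

definition ess_Inf :: "'a measure \<Rightarrow> 'i set \<Rightarrow> ('a \<Rightarrow> 'i \<Rightarrow> real) \<Rightarrow> real" where
  "ess_Inf M I \<Phi> = real_of_ereal (essinf M (\<lambda>\<omega>. INF i\<in>I. ereal (\<Phi> \<omega> i)))"

lemma ess_Inf_eq_minus_ess_Sup: "ess_Inf M I \<Phi> = - ess_Sup M I (\<lambda>\<omega> i. - \<Phi> \<omega> i)"
  unfolding ess_Inf_def ess_Sup_def essinf_def
  by (simp add: ereal_SUP_uminus_eq flip: uminus_ereal.simps(1))

text \<open>Continuity in \<open>i\<close> over a separable index set reduces suprema to countable
  ones, and the uniform bound \<open>C\<close> keeps essential suprema finite.\<close>

locale random_field = prob_space M
  for M :: "'a measure" +
  fixes I :: "'i::{metric_space, second_countable_topology} set"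
    and \<Phi> :: "'a \<Rightarrow> 'i \<Rightarrow> real"
    and C :: real
  assumes nonempty: "I \<noteq> {}"
    and cont: "\<omega> \<in> space M \<Longrightarrow> continuous_on I (\<Phi> \<omega>)"
    and bounded: "\<omega> \<in> space M \<Longrightarrow> i \<in> I \<Longrightarrow> \<bar>\<Phi> \<omega> i\<bar> \<le> C"
    and meas: "i \<in> I \<Longrightarrow> (\<lambda>\<omega>. \<Phi> \<omega> i) \<in> borel_measurable M"
begin

lemma uminus: "random_field M I (\<lambda>\<omega> i. - \<Phi> \<omega> i) C"
  using nonempty cont bounded meas
  by unfold_locales (simp_all add: continuous_on_minus)

text \<open>An uncountable supremum of measurable functions may fail to be measurable, but by
  continuity it agrees with the supremum over a countable dense subset. This is the measurability
  that \<open>esssup_I\<close> asks for.\<close>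

lemma SUP_measurable: "(\<lambda>\<omega>. SUP i\<in>I. ereal (\<Phi> \<omega> i)) \<in> borel_measurable M"
proof -
  obtain D where D: "countable D" "D \<subseteq> I" "I \<subseteq> closure D"
    using separable by blast
  have "(\<lambda>\<omega>. SUP i\<in>D. ereal (\<Phi> \<omega> i)) \<in> borel_measurable M"
    using D meas by (intro borel_measurable_SUP) auto
  moreover have "(SUP i\<in>I. ereal (\<Phi> \<omega> i)) = (SUP i\<in>D. ereal (\<Phi> \<omega> i))" if \<omega>: "\<omega> \<in> space M" for \<omega>
  proof (rule antisym)
    have ne: "D \<noteq> {}"
      using D nonempty by auto
    have "(SUP i\<in>D. ereal (\<Phi> \<omega> i)) \<le> ereal C"
      using D bounded[OF \<omega>] by (intro SUP_least) (auto simp: abs_le_iff)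
    moreover have "(SUP i\<in>D. ereal (\<Phi> \<omega> i)) \<noteq> -\<infinity>"
      using ne by (auto simp: SUP_eq_iff simp flip: bot_ereal_def) (auto simp: bot_ereal_def)
    \<comment> \<open>The supremum over \<open>D\<close> is a real number, so the real-valued
      density lemma applies to it.\<close>
    ultimately obtain c where c: "(SUP i\<in>D. ereal (\<Phi> \<omega> i)) = ereal c"
      by (cases "SUP i\<in>D. ereal (\<Phi> \<omega> i)") auto
    have "\<Phi> \<omega> i \<le> c" if "i \<in> I" for i
    proof (rule continuous_on_le_dense[OF cont[OF \<omega>] D(2,3) _ that])
      fix d assume "d \<in> D"
      then have "ereal (\<Phi> \<omega> d) \<le> ereal c"
        unfolding c[symmetric] by (rule SUP_upper)
      then show "\<Phi> \<omega> d \<le> c"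
        by simp
    qed
    then show "(SUP i\<in>I. ereal (\<Phi> \<omega> i)) \<le> (SUP i\<in>D. ereal (\<Phi> \<omega> i))"
      by (auto simp: c intro: SUP_least)
  qed (use D in \<open>auto intro: SUP_subset_mono\<close>)
  ultimately show ?thesis
    by (subst measurable_cong) auto
qed

text \<open>This trades the extended-real definition for an almost sure statement about all indices
  at once; the later comparison and measurability facts rest on it.\<close>

lemma ess_Sup_le_iff: "ess_Sup M I \<Phi> \<le> c \<longleftrightarrow> (AE \<omega> in M. \<forall>i\<in>I. \<Phi> \<omega> i \<le> c)"
proof -
  let ?X = "\<lambda>\<omega>. SUP i\<in>I. ereal (\<Phi> \<omega> i)"
  have X_le: "?X \<omega> \<le> ereal r \<longleftrightarrow> (\<forall>i\<in>I. \<Phi> \<omega> i \<le> r)" for \<omega> r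
    by (simp add: SUP_le_iff)
  have le: "esssup M ?X \<le> ereal r \<longleftrightarrow> (AE \<omega> in M. \<forall>i\<in>I. \<Phi> \<omega> i \<le> r)" for r
  proof
    assume "esssup M ?X \<le> ereal r"
    then show "AE \<omega> in M. \<forall>i\<in>I. \<Phi> \<omega> i \<le> r"
      using esssup_AE[of ?X M] by (auto simp: X_le[symmetric] elim!: eventually_mono intro: order_trans)
  qed (intro esssup_I SUP_measurable, simp add: X_le)
  have "esssup M ?X \<le> ereal C"
    using bounded by (auto simp: le abs_le_iff intro!: AE_I2)
  \<comment> \<open>Such a bound would contradict \<open>- C \<le> \<Phi> \<omega> i\<close> almost
    surely, which is impossible on a probability space. With the upper bound \<open>C\<close> this
    makes the essential supremum finite, so \<open>real_of_ereal\<close> changes nothing.\<close>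
  moreover have "\<not> esssup M ?X \<le> ereal (- C - 1)"
  proof
    obtain i where i: "i \<in> I"
      using nonempty by blast
    assume "esssup M ?X \<le> ereal (- C - 1)"
    then have "AE \<omega> in M. \<Phi> \<omega> i \<le> - C - 1"
      using i by (auto simp: le elim!: eventually_mono)
    moreover have "AE \<omega> in M. - C \<le> \<Phi> \<omega> i"
      using bounded[OF _ i] by (intro AE_I2) (simp add: abs_le_iff minus_le_iff)
    ultimately have "AE \<omega> in M. False"
      by eventually_elim auto
    then show False
      by simp
  qed
  ultimately obtain r where "esssup M ?X = ereal r"
    by (cases "esssup M ?X") auto
  then show ?thesis
    using le[of c] by (simp add: ess_Sup_def)
qed

lemma le_ess_Inf_iff: "c \<le> ess_Inf M I \<Phi> \<longleftrightarrow> (AE \<omega> in M. \<forall>i\<in>I. c \<le> \<Phi> \<omega> i)"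
  using random_field.ess_Sup_le_iff[OF uminus, of "- c"]
  by (simp add: ess_Inf_eq_minus_ess_Sup le_minus_iff)

lemma ess_Sup_leI: "(\<And>\<omega> i. \<omega> \<in> space M \<Longrightarrow> i \<in> I \<Longrightarrow> \<Phi> \<omega> i \<le> c) \<Longrightarrow> ess_Sup M I \<Phi> \<le> c"
  unfolding ess_Sup_le_iff by (intro AE_I2 ballI) assumption

lemma le_ess_InfI: "(\<And>\<omega> i. \<omega> \<in> space M \<Longrightarrow> i \<in> I \<Longrightarrow> c \<le> \<Phi> \<omega> i) \<Longrightarrow> c \<le> ess_Inf M I \<Phi>"
  unfolding le_ess_Inf_iff by (intro AE_I2 ballI) assumption

lemma ess_Inf_le_ess_Sup: "ess_Inf M I \<Phi> \<le> ess_Sup M I \<Phi>"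
proof -
  obtain i where i: "i \<in> I"
    using nonempty by blast
  have "AE \<omega> in M. \<forall>i\<in>I. \<Phi> \<omega> i \<le> ess_Sup M I \<Phi>" "AE \<omega> in M. \<forall>i\<in>I. ess_Inf M I \<Phi> \<le> \<Phi> \<omega> i"
    using ess_Sup_le_iff le_ess_Inf_iff by blast+
  then have "AE \<omega> in M. ess_Inf M I \<Phi> \<le> ess_Sup M I \<Phi>"
    by eventually_elim (use i in force)
  then show ?thesis
    by simp
qed

lemma ess_Sup_diff_le:
  assumes "random_field M I \<Psi> C'"
    and "\<And>\<omega> i. \<omega> \<in> space M \<Longrightarrow> i \<in> I \<Longrightarrow> \<Phi> \<omega> i \<le> \<Psi> \<omega> i + d"
  shows "ess_Sup M I \<Phi> \<le> ess_Sup M I \<Psi> + d"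
proof -
  have "AE \<omega> in M. \<forall>i\<in>I. \<Psi> \<omega> i \<le> ess_Sup M I \<Psi>"
    using random_field.ess_Sup_le_iff[OF assms(1)] by blast
  then show ?thesis
    unfolding ess_Sup_le_iff using AE_space
  proof eventually_elim
    case (elim \<omega>)
    show ?case
    proof
      fix i assume "i \<in> I"
      then have "\<Phi> \<omega> i \<le> \<Psi> \<omega> i + d" "\<Psi> \<omega> i \<le> ess_Sup M I \<Psi>"
        using elim assms(2) by auto
      then show "\<Phi> \<omega> i \<le> ess_Sup M I \<Psi> + d"
        by simp
    qed
  qed
qed

end

section \<open>Dependence of essential bounds on a parameter\<close>

lemma ess_Sup_dist_le:
  assumes "random_field M I \<Phi> C" "random_field M I \<Psi> C'"
    and "\<And>\<omega> i. \<omega> \<in> space M \<Longrightarrow> i \<in> I \<Longrightarrow> \<bar>\<Phi> \<omega> i - \<Psi> \<omega> i\<bar> \<le> d"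
  shows "\<bar>ess_Sup M I \<Phi> - ess_Sup M I \<Psi>\<bar> \<le> d"
proof -
  have "\<Phi> \<omega> i \<le> \<Psi> \<omega> i + d" "\<Psi> \<omega> i \<le> \<Phi> \<omega> i + d" if "\<omega> \<in> space M" "i \<in> I" for \<omega> i
    using assms(3)[OF that] by linarith+
  then have "ess_Sup M I \<Phi> \<le> ess_Sup M I \<Psi> + d" "ess_Sup M I \<Psi> \<le> ess_Sup M I \<Phi> + d"
    using random_field.ess_Sup_diff_le[OF assms(1,2), of d]
      random_field.ess_Sup_diff_le[OF assms(2,1), of d] by blast+
  then show ?thesis
    by linarith
qed

lemma ess_Inf_dist_le:
  assumes "random_field M I \<Phi> C" "random_field M I \<Psi> C'"
    and "\<And>\<omega> i. \<omega> \<in> space M \<Longrightarrow> i \<in> I \<Longrightarrow> \<bar>\<Phi> \<omega> i - \<Psi> \<omega> i\<bar> \<le> d"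
  shows "\<bar>ess_Inf M I \<Phi> - ess_Inf M I \<Psi>\<bar> \<le> d"
proof -
  have "\<bar>- \<Phi> \<omega> i - - \<Psi> \<omega> i\<bar> \<le> d" if "\<omega> \<in> space M" "i \<in> I" for \<omega> i
    using assms(3)[OF that] by linarith
  then have "\<bar>ess_Sup M I (\<lambda>\<omega> i. - \<Phi> \<omega> i) - ess_Sup M I (\<lambda>\<omega> i. - \<Psi> \<omega> i)\<bar> \<le> d"
    by (rule ess_Sup_dist_le[OF assms(1,2)[THEN random_field.uminus]])
  then show ?thesis
    by (simp add: ess_Inf_eq_minus_ess_Sup)
qed

text \<open>By density, \<open>ess_Sup\<close> is at most \<open>c\<close> at time \<open>t\<close>
  exactly when countably many events \<open>c < \<Phi> t \<omega> d\<close> have probability zero.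
  These probabilities are measurable in \<open>t\<close>, being measures of sections of a jointly
  measurable set.\<close>

lemma borel_measurable_ess_Sup:
  fixes I :: "'i::{metric_space, second_countable_topology} set"
  assumes field: "\<And>t. t \<in> space N \<Longrightarrow> random_field M I (\<Phi> t) C"
    and joint: "\<And>i. i \<in> I \<Longrightarrow> (\<lambda>(t, \<omega>). \<Phi> t \<omega> i) \<in> borel_measurable (N \<Otimes>\<^sub>M M)"
  shows "(\<lambda>t. ess_Sup M I (\<Phi> t)) \<in> borel_measurable N"
proof (cases "space N = {}")
  case True
  then show ?thesis
    by (simp add: measurable_def)
next
  case False
  then interpret prob_space M
    using field random_field.axioms(1) by blast
  obtain D where D: "countable D" "D \<subseteq> I" "I \<subseteq> closure D"
    using separable by blast
  show ?thesis
    unfolding borel_measurable_iff_le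
  proof
    fix c
    have "{t \<in> space N. ess_Sup M I (\<Phi> t) \<le> c}
        = {t \<in> space N. \<forall>d\<in>D. emeasure M {\<omega> \<in> space M. c < \<Phi> t \<omega> d} = 0}"
    proof (rule Collect_cong, rule conj_cong[OF refl])
      fix t assume t: "t \<in> space N"
      interpret random_field M I "\<Phi> t" C
        by (rule field[OF t])
      have "ess_Sup M I (\<Phi> t) \<le> c \<longleftrightarrow> (AE \<omega> in M. \<forall>i\<in>D. \<Phi> t \<omega> i \<le> c)"
        unfolding ess_Sup_le_iff
      proof (rule AE_cong)
        fix \<omega> assume "\<omega> \<in> space M"
        then show "(\<forall>i\<in>I. \<Phi> t \<omega> i \<le> c) \<longleftrightarrow> (\<forall>i\<in>D. \<Phi> t \<omega> i \<le> c)"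
          using D(2) continuous_on_le_dense[OF cont D(2,3)] by (meson subsetD)
      qed
      also have "\<dots> \<longleftrightarrow> (\<forall>i\<in>D. AE \<omega> in M. \<Phi> t \<omega> i \<le> c)"
        using D(1) by (rule AE_ball_countable)
      also have "\<dots> \<longleftrightarrow> (\<forall>d\<in>D. emeasure M {\<omega> \<in> space M. c < \<Phi> t \<omega> d} = 0)"
      proof (intro ball_cong refl AE_iff_measurable)
        fix d assume "d \<in> D"
        then have [measurable]: "(\<lambda>\<omega>. \<Phi> t \<omega> d) \<in> borel_measurable M"
          using D(2) meas by blast
        show "{\<omega> \<in> space M. c < \<Phi> t \<omega> d} \<in> sets M"
          by measurable
      qed (auto simp: not_le)
      finally show "ess_Sup M I (\<Phi> t) \<le> c \<longleftrightarrow>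
          (\<forall>d\<in>D. emeasure M {\<omega> \<in> space M. c < \<Phi> t \<omega> d} = 0)" .
    qed
    also have "\<dots> \<in> sets N"
    proof (rule sets.sets_Collect_countable_All'[OF _ D(1)])
      fix d assume "d \<in> D"
      then have [measurable]: "(\<lambda>(t, \<omega>). \<Phi> t \<omega> d) \<in> borel_measurable (N \<Otimes>\<^sub>M M)"
        using D joint by auto
      have [measurable]: "(\<lambda>t. emeasure M {\<omega> \<in> space M. c < \<Phi> t \<omega> d}) \<in> borel_measurable N"
        by measurable
      show "{t \<in> space N. emeasure M {\<omega> \<in> space M. c < \<Phi> t \<omega> d} = 0} \<in> sets N"
        by measurable
    qed
    finally show "{t \<in> space N. ess_Sup M I (\<Phi> t) \<le> c} \<in> sets N" .
  qed
qed

lemma borel_measurable_ess_Inf: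
  fixes I :: "'i::{metric_space, second_countable_topology} set"
  assumes "\<And>t. t \<in> space N \<Longrightarrow> random_field M I (\<Phi> t) C"
    and "\<And>i. i \<in> I \<Longrightarrow> (\<lambda>(t, \<omega>). \<Phi> t \<omega> i) \<in> borel_measurable (N \<Otimes>\<^sub>M M)"
  shows "(\<lambda>t. ess_Inf M I (\<Phi> t)) \<in> borel_measurable N"
proof -
  have "(\<lambda>(t, \<omega>). - \<Phi> t \<omega> i) \<in> borel_measurable (N \<Otimes>\<^sub>M M)" if "i \<in> I" for i
    using borel_measurable_uminus[OF assms(2)[OF that]] by (simp add: case_prod_beta)
  then have "(\<lambda>t. ess_Sup M I (\<lambda>\<omega> i. - \<Phi> t \<omega> i)) \<in> borel_measurable N"
    using assms(1)[THEN random_field.uminus] by (rule borel_measurable_ess_Sup[rotated])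
  then show ?thesis
    unfolding ess_Inf_eq_minus_ess_Sup by (rule borel_measurable_uminus)
qed

section \<open>Difference quotients\<close>

lemma off_diag_iff:
  "p \<in> off_diag \<longleftrightarrow> fst (fst p) \<noteq> fst (snd p) \<and> fst (snd (fst p)) \<noteq> fst (snd (snd p)) \<and>
    snd (snd (fst p)) \<noteq> snd (snd (snd p))"
  by (cases p) (auto simp: off_diag_def)

text \<open>On \<open>off_diag\<close> all three increments are nonzero, so the quotients are
  ordinary fractions that inherit bounds, continuity and measurability from
  \<open>\<phi>\<close>.\<close>

lemma dq_off_diag:
  assumes "p \<in> off_diag"
  shows "dq1 \<phi> (fst p) (snd p) =
      (\<phi> (fst (fst p), snd (fst p)) - \<phi> (fst (snd p), snd (fst p))) / (fst (fst p) - fst (snd p))"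
    and "dq2 \<phi> (fst p) (snd p) =
      (\<phi> (fst (snd p), snd (fst p)) - \<phi> (fst (snd p), fst (snd (snd p)), snd (snd (fst p)))) /
      (fst (snd (fst p)) - fst (snd (snd p)))"
    and "dq3 \<phi> (fst p) (snd p) =
      (\<phi> (fst (snd p), fst (snd (snd p)), snd (snd (fst p))) - \<phi> (snd p)) /
      (snd (snd (fst p)) - snd (snd (snd p)))"
  using assms by (cases p; auto simp: off_diag_iff diff_quot_def)+

lemma abs_lipschitz_quotient_le:
  fixes \<phi> :: "'b::metric_space \<Rightarrow> real"
  assumes "K-lipschitz_on UNIV \<phi>" "dist u v = \<bar>r\<bar>"
  shows "\<bar>(\<phi> u - \<phi> v) / r\<bar> \<le> K"
\<comment> \<open>Division by zero yields zero, so the bound then only needs \<open>K\<close> to be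
  nonnegative.\<close>
proof (cases "r = 0")
  case True
  then show ?thesis
    using lipschitz_on_nonneg[OF assms(1)] by simp
next
  case False
  then show ?thesis
    using lipschitz_onD[OF assms(1), of u v] assms(2)
    by (simp add: dist_real_def divide_le_eq)
qed

lemma abs_dq_le:
  assumes "K-lipschitz_on UNIV \<phi>" "p \<in> off_diag"
  shows "\<bar>dq1 \<phi> (fst p) (snd p)\<bar> \<le> K" "\<bar>dq2 \<phi> (fst p) (snd p)\<bar> \<le> K" "\<bar>dq3 \<phi> (fst p) (snd p)\<bar> \<le> K"
  unfolding dq_off_diag[OF assms(2)]
  by (rule abs_lipschitz_quotient_le[OF assms(1)]; cases p; auto simp: dist_Pair_Pair dist_real_def)+

lemma continuous_on_dq:
  assumes \<phi>: "continuous_on UNIV \<phi>"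
  shows "continuous_on off_diag (\<lambda>p. dq1 \<phi> (fst p) (snd p))"
    and "continuous_on off_diag (\<lambda>p. dq2 \<phi> (fst p) (snd p))"
    and "continuous_on off_diag (\<lambda>p. dq3 \<phi> (fst p) (snd p))"
proof -
  note [continuous_intros] = continuous_on_compose2[OF \<phi>]
  show "continuous_on off_diag (\<lambda>p. dq1 \<phi> (fst p) (snd p))"
    by (subst continuous_on_cong[OF refl dq_off_diag(1)], assumption)
      (auto intro!: continuous_intros simp: off_diag_iff)
  show "continuous_on off_diag (\<lambda>p. dq2 \<phi> (fst p) (snd p))"
    by (subst continuous_on_cong[OF refl dq_off_diag(2)], assumption)
      (auto intro!: continuous_intros simp: off_diag_iff)
  show "continuous_on off_diag (\<lambda>p. dq3 \<phi> (fst p) (snd p))"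
    by (subst continuous_on_cong[OF refl dq_off_diag(3)], assumption)
      (auto intro!: continuous_intros simp: off_diag_iff)
qed

lemma borel_measurable_dq:
  assumes [measurable]: "\<And>\<theta>. (\<lambda>x. \<phi> x \<theta>) \<in> borel_measurable N" and p: "p \<in> off_diag"
  shows "(\<lambda>x. dq1 (\<phi> x) (fst p) (snd p)) \<in> borel_measurable N"
    and "(\<lambda>x. dq2 (\<phi> x) (fst p) (snd p)) \<in> borel_measurable N"
    and "(\<lambda>x. dq3 (\<phi> x) (fst p) (snd p)) \<in> borel_measurable N"
  unfolding dq_off_diag[OF p] by measurable

section \<open>The dominating quantities as essential bounds of random fields\<close>

lemma F_upper_eq_ess_Sup:
  "F_upper M b \<sigma> f t y = ess_Sup M off_diag (\<lambda>\<omega> p. char_F b \<sigma> f t \<omega> (fst p) (snd p) y)"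
  unfolding F_upper_def ess_Sup_def by (simp add: case_prod_beta)

lemma F_lower_eq_ess_Inf:
  "F_lower M b \<sigma> f t y = ess_Inf M off_diag (\<lambda>\<omega> p. char_F b \<sigma> f t \<omega> (fst p) (snd p) y)"
  unfolding F_lower_def ess_Inf_def by (simp add: case_prod_beta)

lemma h_upper_eq_ess_Sup:
  "h_upper M g = ess_Sup M {(x1, x2). x1 \<noteq> x2} (\<lambda>\<omega> p. diff_quot (\<lambda>x. g x \<omega>) (fst p) (snd p))"
  unfolding h_upper_def ess_Sup_def by (simp add: case_prod_beta)

lemma h_lower_eq_ess_Inf:
  "h_lower M g = ess_Inf M {(x1, x2). x1 \<noteq> x2} (\<lambda>\<omega> p. diff_quot (\<lambda>x. g x \<omega>) (fst p) (snd p))"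
  unfolding h_lower_def ess_Inf_def by (simp add: case_prod_beta)

text \<open>The generating events and the added null sets all belong to \<open>M\<close>. Composing
  with the identity therefore turns measurability for the filtration into measurability for
  \<open>M\<close>.\<close>

lemma id_measurable_augmented_filtration:
  assumes "\<And>s. 0 \<le> s \<Longrightarrow> B s \<in> borel_measurable M"
  shows "(\<lambda>\<omega>. \<omega>) \<in> measurable M (augmented_filtration M B t)"
  unfolding augmented_filtration_def
proof (rule measurable_measure_of)
  show "{B s -` A \<inter> space M |s A. 0 \<le> s \<and> s \<le> t \<and> A \<in> sets borel} \<union> null_sets M \<subseteq> Pow (space M)"
    by (auto dest: null_setsD2 sets.sets_into_space)
  show "(\<lambda>\<omega>. \<omega>) -` E \<inter> space M \<in> sets M"
    if "E \<in> {B s -` A \<inter> space M |s A. 0 \<le> s \<and> s \<le> t \<and> A \<in> sets borel} \<union> null_sets M" for E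
    using that assms by (auto intro: measurable_sets)
qed auto

section \<open>The dominating drivers\<close>

locale lipschitz_coefficients = prob_space M
  for M :: "'a measure" +
  fixes B :: "real \<Rightarrow> 'a \<Rightarrow> real" and T K :: real
    and b \<sigma> f :: "'a coeff" and g :: "real \<Rightarrow> 'a \<Rightarrow> real"
  assumes T_pos: "T > 0" and K_pos: "K > 0"
    and B_meas: "\<And>s. 0 \<le> s \<Longrightarrow> B s \<in> borel_measurable M"
    and standing: "standing_assumption M B T K b \<sigma> f g"
    and no_z: "\<And>t \<omega> x y z z'. t \<in> {0..T} \<Longrightarrow> \<omega> \<in> space M \<Longrightarrow> \<sigma> t \<omega> (x, y, z) = \<sigma> t \<omega> (x, y, z')"
begin

section \<open>Regularity drawn from the standing assumption\<close>

lemma lipschitz: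
  assumes "t \<in> {0..T}" "\<omega> \<in> space M"
  shows "K-lipschitz_on UNIV (b t \<omega>)" "K-lipschitz_on UNIV (\<sigma> t \<omega>)" "K-lipschitz_on UNIV (f t \<omega>)"
  using standing assms unfolding standing_assumption_def by auto

lemma g_lipschitz: "\<omega> \<in> space M \<Longrightarrow> K-lipschitz_on UNIV (\<lambda>x. g x \<omega>)"
  using standing unfolding standing_assumption_def by auto

lemma g_measurable: "g x \<in> borel_measurable M"
proof -
  have "g x \<in> borel_measurable (augmented_filtration M B T)"
    using standing unfolding standing_assumption_def by blast
  from measurable_compose[OF id_measurable_augmented_filtration[OF B_meas] this] show ?thesis
    by simp
qed

text \<open>Progressive measurability at the final time \<open>T\<close> is joint measurability on
  the whole strip, up to replacing the filtration by \<open>M\<close> in the second factor.\<close>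

lemma prog_measurable_imp_joint:
  assumes "prog_measurable (augmented_filtration M B) T X"
  shows "(\<lambda>q. X (fst q) (snd q)) \<in> borel_measurable (restrict_space borel {0..T} \<Otimes>\<^sub>M M)"
proof -
  let ?N = "restrict_space borel {0..T} \<Otimes>\<^sub>M M"
  have X: "(\<lambda>(s, \<omega>). X s \<omega>) \<in> borel_measurable (restrict_space borel {0..T} \<Otimes>\<^sub>M augmented_filtration M B T)"
    using assms T_pos unfolding prog_measurable_def by simp
  have "(\<lambda>q. (fst q, snd q)) \<in> measurable ?N (restrict_space borel {0..T} \<Otimes>\<^sub>M augmented_filtration M B T)"
    by (rule measurable_Pair[OF measurable_fst
        measurable_compose[OF measurable_snd id_measurable_augmented_filtration[OF B_meas]]])
  from measurable_compose[OF this X] show ?thesis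
    by simp
qed

lemma coeff_measurable:
  "(\<lambda>q. b (fst q) (snd q) \<theta>) \<in> borel_measurable (restrict_space borel {0..T} \<Otimes>\<^sub>M M)"
  "(\<lambda>q. \<sigma> (fst q) (snd q) \<theta>) \<in> borel_measurable (restrict_space borel {0..T} \<Otimes>\<^sub>M M)"
  "(\<lambda>q. f (fst q) (snd q) \<theta>) \<in> borel_measurable (restrict_space borel {0..T} \<Otimes>\<^sub>M M)"
proof -
  have "prog_measurable (augmented_filtration M B) T (\<lambda>t \<omega>. b t \<omega> \<theta>)"
    "prog_measurable (augmented_filtration M B) T (\<lambda>t \<omega>. \<sigma> t \<omega> \<theta>)"
    "prog_measurable (augmented_filtration M B) T (\<lambda>t \<omega>. f t \<omega> \<theta>)"
    using standing unfolding standing_assumption_def by blast+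
  from this[THEN prog_measurable_imp_joint]
  show "(\<lambda>q. b (fst q) (snd q) \<theta>) \<in> borel_measurable (restrict_space borel {0..T} \<Otimes>\<^sub>M M)"
    "(\<lambda>q. \<sigma> (fst q) (snd q) \<theta>) \<in> borel_measurable (restrict_space borel {0..T} \<Otimes>\<^sub>M M)"
    "(\<lambda>q. f (fst q) (snd q) \<theta>) \<in> borel_measurable (restrict_space borel {0..T} \<Otimes>\<^sub>M M)"
    by simp_all
qed

section \<open>The driver as a cubic polynomial\<close>

abbreviation lin_coeff where
  "lin_coeff t \<omega> p \<equiv> dq2 (f t \<omega>) (fst p) (snd p) + dq1 (b t \<omega>) (fst p) (snd p)
     + dq1 (\<sigma> t \<omega>) (fst p) (snd p) * dq3 (f t \<omega>) (fst p) (snd p)"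

abbreviation quad where "quad t \<omega> p \<equiv> quad_coeff b \<sigma> f t \<omega> (fst p) (snd p)"

abbreviation cubic where "cubic t \<omega> p \<equiv> cubic_coeff b \<sigma> t \<omega> (fst p) (snd p)"

abbreviation driver where "driver t y \<omega> p \<equiv> char_F b \<sigma> f t \<omega> (fst p) (snd p) y"

text \<open>Independence of \<open>z\<close> makes the quotient \<open>dq3\<close> of
  \<open>\<sigma>\<close> vanish, so the denominator in \<open>char_F\<close> is 1 and the
  expression expands into powers of \<open>y\<close>.\<close>

lemma driver_eq:
  assumes "t \<in> {0..T}" "\<omega> \<in> space M" "p \<in> off_diag"
  shows "driver t y \<omega> p = dq1 (f t \<omega>) (fst p) (snd p) + lin_coeff t \<omega> p * y
    + quad t \<omega> p * y^2 + cubic t \<omega> p * y^3"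
proof -
  have "\<sigma> t \<omega> (fst (snd p), fst (snd (snd p)), snd (snd (fst p))) = \<sigma> t \<omega> (snd p)"
    using no_z[OF assms(1,2)] by (metis prod.collapse)
  then have "dq3 (\<sigma> t \<omega>) (fst p) (snd p) = 0"
    by (simp add: dq_off_diag(3)[OF assms(3)])
  then show ?thesis
    by (simp add: char_F_def quad_coeff_def cubic_coeff_def Let_def)
      (simp add: algebra_simps power2_eq_square power3_eq_cube)
qed

lemma coeff_bounds:
  assumes "t \<in> {0..T}" "\<omega> \<in> space M" "p \<in> off_diag"
  shows "\<bar>dq1 (f t \<omega>) (fst p) (snd p)\<bar> \<le> K"
    and "\<bar>lin_coeff t \<omega> p\<bar> \<le> 2 * K + K^2"
    and "\<bar>quad t \<omega> p\<bar> \<le> K + 2 * K^2"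
    and "\<bar>cubic t \<omega> p\<bar> \<le> K^2"
proof -
  \<comment> \<open>Facts 1 to 3 bound \<open>dq1\<close> of \<open>b\<close>,
    \<open>\<sigma>\<close>, \<open>f\<close> in this order, facts 4 to 6 bound \<open>dq2\<close>,
    and facts 7 to 9 bound \<open>dq3\<close>.\<close>
  note bd = lipschitz[OF assms(1,2), THEN abs_dq_le(1)[OF _ assms(3)]]
    lipschitz[OF assms(1,2), THEN abs_dq_le(2)[OF _ assms(3)]]
    lipschitz[OF assms(1,2), THEN abs_dq_le(3)[OF _ assms(3)]]
  have mult: "\<bar>u * v\<bar> \<le> K^2" if "\<bar>u\<bar> \<le> K" "\<bar>v\<bar> \<le> K" for u v
    using that K_pos by (auto simp: abs_mult power2_eq_square intro: mult_mono)
  show "\<bar>dq1 (f t \<omega>) (fst p) (snd p)\<bar> \<le> K"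
    by (rule bd)
  show "\<bar>lin_coeff t \<omega> p\<bar> \<le> 2 * K + K^2"
    using bd(6) bd(1) mult[OF bd(2) bd(9)] by linarith
  show "\<bar>quad t \<omega> p\<bar> \<le> K + 2 * K^2"
    unfolding quad_coeff_def using bd(4) mult[OF bd(9) bd(5)] mult[OF bd(7) bd(2)] by linarith
  show "\<bar>cubic t \<omega> p\<bar> \<le> K^2"
    unfolding cubic_coeff_def by (rule mult[OF bd(5) bd(7)])
qed

definition driver_bound where
  "driver_bound y = K + (2 * K + K^2) * \<bar>y\<bar> + (K + 2 * K^2) * \<bar>y\<bar>^2 + K^2 * \<bar>y\<bar>^3"

lemma abs_driver_le:
  assumes "t \<in> {0..T}" "\<omega> \<in> space M" "p \<in> off_diag"
  shows "\<bar>driver t y \<omega> p\<bar> \<le> driver_bound y"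
proof -
  have "\<bar>lin_coeff t \<omega> p * y\<bar> \<le> (2 * K + K^2) * \<bar>y\<bar>"
    "\<bar>quad t \<omega> p * y^2\<bar> \<le> (K + 2 * K^2) * \<bar>y\<bar>^2"
    "\<bar>cubic t \<omega> p * y^3\<bar> \<le> K^2 * \<bar>y\<bar>^3"
    unfolding abs_mult power_abs by (intro mult_right_mono coeff_bounds[OF assms]; simp)+
  then show ?thesis
    unfolding driver_eq[OF assms] driver_bound_def using coeff_bounds(1)[OF assms] by linarith
qed

lemma driver_lipschitz:
  assumes "t \<in> {0..T}" "\<omega> \<in> space M" "p \<in> off_diag" "\<bar>y\<bar> \<le> R" "\<bar>y'\<bar> \<le> R"
  shows "\<bar>driver t y \<omega> p - driver t y' \<omega> p\<bar>
    \<le> ((2 * K + K^2) + (K + 2 * K^2) * (2 * R) + K^2 * (3 * R^2)) * \<bar>y - y'\<bar>"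
proof -
  \<comment> \<open>The cofactor of \<open>y - y'\<close> in the difference of the two
    cubics.\<close>
  let ?d = "lin_coeff t \<omega> p + quad t \<omega> p * (y + y') + cubic t \<omega> p * (y^2 + y * y' + y'^2)"
  have R: "R \<ge> 0"
    using assms(4) by linarith
  have "\<bar>y * y'\<bar> \<le> R^2" "\<bar>y^2\<bar> \<le> R^2" "\<bar>y'^2\<bar> \<le> R^2"
    unfolding power2_eq_square abs_mult using assms(4,5) R by (intro mult_mono; simp)+
  then have yy: "\<bar>y^2 + y * y' + y'^2\<bar> \<le> 3 * R^2"
    by linarith
  have "driver t y \<omega> p - driver t y' \<omega> p = ?d * (y - y')"
    unfolding driver_eq[OF assms(1-3)] by (simp add: algebra_simps power2_eq_square power3_eq_cube)
  moreover have "\<bar>?d\<bar> \<le> (2 * K + K^2) + (K + 2 * K^2) * (2 * R) + K^2 * (3 * R^2)"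
  proof -
    have "\<bar>quad t \<omega> p * (y + y')\<bar> \<le> (K + 2 * K^2) * (2 * R)"
      unfolding abs_mult using assms(4,5) K_pos by (intro mult_mono coeff_bounds[OF assms(1-3)]) auto
    moreover have "\<bar>cubic t \<omega> p * (y^2 + y * y' + y'^2)\<bar> \<le> K^2 * (3 * R^2)"
      unfolding abs_mult using yy K_pos by (intro mult_mono coeff_bounds[OF assms(1-3)]) auto
    ultimately show ?thesis
      using coeff_bounds(2)[OF assms(1-3)] by linarith
  qed
  ultimately show ?thesis
    by (simp add: abs_mult mult_right_mono)
qed

lemma driver_measurable:
  assumes p: "p \<in> off_diag"
  shows "(\<lambda>(t, \<omega>). driver t y \<omega> p) \<in> borel_measurable (restrict_space borel {0..T} \<Otimes>\<^sub>M M)"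
proof -
  note [measurable] = coeff_measurable[THEN borel_measurable_dq(1)[OF _ p]]
    coeff_measurable[THEN borel_measurable_dq(2)[OF _ p]]
    coeff_measurable[THEN borel_measurable_dq(3)[OF _ p]]
  show ?thesis
    unfolding char_F_def Let_def case_prod_beta by measurable
qed

text \<open>The bound \<open>driver_bound y\<close> is the same for every \<open>t\<close>, since
  \<open>borel_measurable_ess_Sup\<close> works with one constant for the whole family.\<close>

lemma driver_random_field:
  assumes t: "t \<in> {0..T}"
  shows "random_field M off_diag (driver t y) (driver_bound y)"
proof
  have "((0, 0, 0), (1, 1, 1)) \<in> off_diag"
    by (simp add: off_diag_iff)
  then show "off_diag \<noteq> {}"
    by blast
  show "continuous_on off_diag (driver t y \<omega>)" if \<omega>: "\<omega> \<in> space M" for \<omega>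
  \<comment> \<open>In polynomial form there is no denominator whose zeros would have to be
    excluded.\<close>
  proof (subst continuous_on_cong[OF refl driver_eq[OF t \<omega>]])
    note [continuous_intros] =
      lipschitz[OF t \<omega>, THEN lipschitz_on_continuous_on, THEN continuous_on_dq(1)]
      lipschitz[OF t \<omega>, THEN lipschitz_on_continuous_on, THEN continuous_on_dq(2)]
      lipschitz[OF t \<omega>, THEN lipschitz_on_continuous_on, THEN continuous_on_dq(3)]
    show "continuous_on off_diag (\<lambda>p. dq1 (f t \<omega>) (fst p) (snd p) + lin_coeff t \<omega> p * y
        + quad t \<omega> p * y^2 + cubic t \<omega> p * y^3)"
      unfolding quad_coeff_def cubic_coeff_def by (intro continuous_intros)
  qed
  show "(\<lambda>\<omega>. driver t y \<omega> p) \<in> borel_measurable M" if "p \<in> off_diag" for p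
    using measurable_compose_Pair1[OF _ driver_measurable[OF that, of y], of t] t
    by (simp add: space_restrict_space)
qed (use abs_driver_le t in auto)

lemma h_random_field:
  "random_field M {(x1, x2). x1 \<noteq> x2} (\<lambda>\<omega> p. diff_quot (\<lambda>x. g x \<omega>) (fst p) (snd p)) K"
proof
  let ?I = "{(x1, x2). x1 \<noteq> (x2::real)}"
  have eq: "diff_quot \<psi> (fst p) (snd p) = (\<psi> (fst p) - \<psi> (snd p)) / (fst p - snd p)" if "p \<in> ?I" for \<psi> p
    using that by (auto simp: diff_quot_def)
  have "(0, 1) \<in> ?I"
    by simp
  then show "?I \<noteq> {}"
    by blast
  show "continuous_on ?I (\<lambda>p. diff_quot (\<lambda>x. g x \<omega>) (fst p) (snd p))" if "\<omega> \<in> space M" for \<omega>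
  proof (subst continuous_on_cong[OF refl eq])
    note [continuous_intros] = continuous_on_compose2[OF lipschitz_on_continuous_on[OF g_lipschitz[OF that]]]
    show "continuous_on ?I (\<lambda>p. (g (fst p) \<omega> - g (snd p) \<omega>) / (fst p - snd p))"
      by (intro continuous_intros) auto
  qed
  show "\<bar>diff_quot (\<lambda>x. g x \<omega>) (fst p) (snd p)\<bar> \<le> K" if "\<omega> \<in> space M" "p \<in> ?I" for \<omega> p
    unfolding eq[OF that(2)]
    by (rule abs_lipschitz_quotient_le[OF g_lipschitz[OF that(1)]]) (simp add: dist_real_def)
  show "(\<lambda>\<omega>. diff_quot (\<lambda>x. g x \<omega>) (fst p) (snd p)) \<in> borel_measurable M" if "p \<in> ?I" for p
    unfolding eq[OF that] using g_measurable by measurable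
qed

lemma h_bounds: "- K \<le> h_lower M g" "h_lower M g \<le> h_upper M g" "h_upper M g \<le> K"
proof -
  interpret h: random_field M "{(x1, x2). x1 \<noteq> x2}" "\<lambda>\<omega> p. diff_quot (\<lambda>x. g x \<omega>) (fst p) (snd p)" K
    by (rule h_random_field)
  show "h_lower M g \<le> h_upper M g"
    unfolding h_lower_eq_ess_Inf h_upper_eq_ess_Sup by (rule h.ess_Inf_le_ess_Sup)
  show "- K \<le> h_lower M g"
    unfolding h_lower_eq_ess_Inf using h.bounded by (intro h.le_ess_InfI) (simp add: abs_le_iff minus_le_iff)
  show "h_upper M g \<le> K"
    unfolding h_upper_eq_ess_Sup using h.bounded by (intro h.ess_Sup_leI) (simp add: abs_le_iff)
qed

section \<open>Regularity of the dominating drivers and reduction to barriers\<close>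

abbreviation "F_up \<equiv> F_upper M b \<sigma> f"
abbreviation "F_low \<equiv> F_lower M b \<sigma> f"

lemma F_low_le_F_up: "t \<in> {0..T} \<Longrightarrow> F_low t y \<le> F_up t y"
  unfolding F_lower_eq_ess_Inf F_upper_eq_ess_Sup
  by (rule random_field.ess_Inf_le_ess_Sup[OF driver_random_field])

lemma F_up_leI:
  assumes "t \<in> {0..T}" "\<And>\<omega> p. \<omega> \<in> space M \<Longrightarrow> p \<in> off_diag \<Longrightarrow> driver t y \<omega> p \<le> c"
  shows "F_up t y \<le> c"
  unfolding F_upper_eq_ess_Sup using assms
  by (intro random_field.ess_Sup_leI[OF driver_random_field])

lemma le_F_lowI:
  assumes "t \<in> {0..T}" "\<And>\<omega> p. \<omega> \<in> space M \<Longrightarrow> p \<in> off_diag \<Longrightarrow> c \<le> driver t y \<omega> p"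
  shows "c \<le> F_low t y"
  unfolding F_lower_eq_ess_Inf using assms
  by (intro random_field.le_ess_InfI[OF driver_random_field])

lemma F_measurable:
  "(\<lambda>t. F_up t y) \<in> borel_measurable (restrict_space borel {0..T})"
  "(\<lambda>t. F_low t y) \<in> borel_measurable (restrict_space borel {0..T})"
  unfolding F_upper_eq_ess_Sup F_lower_eq_ess_Inf
  by (rule borel_measurable_ess_Sup borel_measurable_ess_Inf,
      rule driver_random_field, simp add: space_restrict_space, erule driver_measurable)+

lemma F_lipschitz:
  assumes "t \<in> {0..T}" "\<bar>y\<bar> \<le> R" "\<bar>y'\<bar> \<le> R"
  defines "L \<equiv> (2 * K + K^2) + (K + 2 * K^2) * (2 * R) + K^2 * (3 * R^2)"
  shows "\<bar>F_up t y - F_up t y'\<bar> \<le> L * \<bar>y - y'\<bar>" "\<bar>F_low t y - F_low t y'\<bar> \<le> L * \<bar>y - y'\<bar>"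
  unfolding F_upper_eq_ess_Sup F_lower_eq_ess_Inf L_def
  by (rule ess_Sup_dist_le[OF driver_random_field driver_random_field]
      ess_Inf_dist_le[OF driver_random_field driver_random_field];
      use assms driver_lipschitz in auto)+

lemma F_bounds: "t \<in> {0..T} \<Longrightarrow> - driver_bound y \<le> F_low t y" "t \<in> {0..T} \<Longrightarrow> F_up t y \<le> driver_bound y"
  using abs_driver_le[of t _ _ y]
  by (auto intro!: le_F_lowI F_up_leI simp: abs_le_iff minus_le_iff)

text \<open>One pair of barriers serves both equations: since \<open>F_low \<le> F_up\<close> and
  \<open>h_lower M g \<le> h_upper M g\<close>, a subsolution of the lower equation is one of the
  upper, and a supersolution of the upper is one of the lower.\<close>

lemma solutions_between_barriers:
  assumes \<alpha>: "\<And>s. s \<in> {0..T} \<Longrightarrow> (\<alpha> has_real_derivative \<alpha>' s) (at s within {0..T})"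
    and \<beta>: "\<And>s. s \<in> {0..T} \<Longrightarrow> (\<beta> has_real_derivative \<beta>' s) (at s within {0..T})"
    and \<alpha>\<beta>: "\<And>s. s \<in> {0..T} \<Longrightarrow> \<alpha> s \<le> \<beta> s"
    and sub: "\<And>s. s \<in> {0..T} \<Longrightarrow> - \<alpha>' s \<le> F_low s (\<alpha> s)"
    and super: "\<And>s. s \<in> {0..T} \<Longrightarrow> F_up s (\<beta> s) \<le> - \<beta>' s"
    and terminal: "\<alpha> T \<le> h_lower M g" "h_upper M g \<le> \<beta> T"
  shows "(\<exists>y. bounded_backward_solution T (h_upper M g) F_up y) \<and>
    (\<exists>y. bounded_backward_solution T (h_lower M g) F_low y)"
proof
  have bd: "\<bar>F_up s 0\<bar> \<le> driver_bound 0" "\<bar>F_low s 0\<bar> \<le> driver_bound 0" if "s \<in> {0..T}" for s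
    using F_bounds[OF that, of 0] F_low_le_F_up[OF that, of 0] by linarith+
  have L: "\<exists>L. \<forall>s\<in>{0..T}. \<forall>y y'. \<bar>y\<bar> \<le> R \<longrightarrow> \<bar>y'\<bar> \<le> R \<longrightarrow> \<bar>F_up s y - F_up s y'\<bar> \<le> L * \<bar>y - y'\<bar>"
    "\<exists>L. \<forall>s\<in>{0..T}. \<forall>y y'. \<bar>y\<bar> \<le> R \<longrightarrow> \<bar>y'\<bar> \<le> R \<longrightarrow> \<bar>F_low s y - F_low s y'\<bar> \<le> L * \<bar>y - y'\<bar>" for R
    using F_lipschitz by blast+
  have T: "0 \<le> T"
    using T_pos by simp
  show "\<exists>y. bounded_backward_solution T (h_upper M g) F_up y"
  proof (rule backward_solution_between_barriers[where T = T and G = F_up and \<alpha> = \<alpha> and \<beta> = \<beta>,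
        OF T F_measurable(1) L(1) bd(1) \<alpha> \<beta> \<alpha>\<beta> _ super])
    show "- \<alpha>' s \<le> F_up s (\<alpha> s)" if "s \<in> {0..T}" for s
      using sub[OF that] F_low_le_F_up[OF that] by (rule order_trans)
    show "\<alpha> T \<le> h_upper M g" "h_upper M g \<le> \<beta> T"
      using terminal h_bounds(2) by linarith+
  qed
  show "\<exists>y. bounded_backward_solution T (h_lower M g) F_low y"
  proof (rule backward_solution_between_barriers[where T = T and G = F_low and \<alpha> = \<alpha> and \<beta> = \<beta>,
        OF T F_measurable(2) L(2) bd(2) \<alpha> \<beta> \<alpha>\<beta> sub])
    show "F_low s (\<beta> s) \<le> - \<beta>' s" if "s \<in> {0..T}" for s
      using F_low_le_F_up[OF that] super[OF that] by (rule order_trans)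
    show "\<alpha> T \<le> h_lower M g" "h_lower M g \<le> \<beta> T"
      using terminal h_bounds(2) by linarith+
  qed
qed

section \<open>Barriers\<close>

text \<open>This is the bound on \<open>lin_coeff\<close>; it also dominates \<open>K\<close>, the
  bound on the constant term.\<close>

definition rate :: real where "rate = 2 * K + K^2"

text \<open>The factor 3 leaves one multiple of \<open>rate\<close> for each of the constant term, the linear term,
  and the quadratic and cubic terms together.\<close>

definition exp_barrier :: "real \<Rightarrow> real \<Rightarrow> real" where
  "exp_barrier R t = R * exp (3 * rate * (T - t))"

lemma rate_pos: "rate > 0"
  using K_pos by (simp add: rate_def add_pos_pos)

lemma exp_barrier_deriv:
  "(exp_barrier R has_real_derivative - (3 * rate * exp_barrier R t)) (at t within S)"
  unfolding exp_barrier_def by (auto intro!: derivative_eq_intros)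

lemma exp_barrier_terminal: "exp_barrier R T = R"
  by (simp add: exp_barrier_def)

lemma exp_barrier_ge:
  assumes "0 \<le> R" "t \<in> {0..T}"
  shows "R \<le> exp_barrier R t"
proof -
  have "1 \<le> exp (3 * rate * (T - t))"
    using assms(2) rate_pos by simp
  from mult_left_mono[OF this assms(1)] show ?thesis
    by (simp add: exp_barrier_def)
qed

lemma exp_barrier_le:
  assumes "0 \<le> R" "t \<in> {0..T}"
  shows "exp_barrier R t \<le> R * exp (3 * rate * T)"
  unfolding exp_barrier_def using assms rate_pos by (intro mult_left_mono) auto

text \<open>From \<open>1 \<le> R\<close> the barrier stays above 1, so even the constant term is at
  most \<open>rate\<close> times the barrier. The hypothesis \<open>le\<close> isolates the
  nonlinear terms, the only ones that differ from case to case.\<close>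

lemma exp_barrier_super:
  assumes t: "t \<in> {0..T}" and R: "1 \<le> R"
    and le: "\<And>\<omega> p. \<omega> \<in> space M \<Longrightarrow> p \<in> off_diag \<Longrightarrow>
      quad t \<omega> p * (exp_barrier R t)^2 + cubic t \<omega> p * (exp_barrier R t)^3 \<le> rate * exp_barrier R t"
  shows "F_up t (exp_barrier R t) \<le> 3 * rate * exp_barrier R t"
proof (rule F_up_leI[OF t])
  let ?B = "exp_barrier R t"
  have B: "1 \<le> ?B"
    using exp_barrier_ge[of R t] R t by linarith
  have "K \<le> rate"
    using K_pos by (simp add: rate_def)
  then have K: "K \<le> rate * ?B"
    using B K_pos mult_mono[of K rate 1 ?B] by simp
  fix \<omega> p assume \<omega>p: "\<omega> \<in> space M" "p \<in> off_diag"
  have "lin_coeff t \<omega> p * ?B \<le> rate * ?B"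
    using coeff_bounds(2)[OF t \<omega>p] B by (intro mult_right_mono) (auto simp: rate_def)
  moreover have "dq1 (f t \<omega>) (fst p) (snd p) \<le> K"
    using coeff_bounds(1)[OF t \<omega>p] by linarith
  ultimately show "driver t ?B \<omega> p \<le> 3 * rate * ?B"
    unfolding driver_eq[OF t \<omega>p] using le[OF \<omega>p] K by linarith
qed

text \<open>The mirror image at the negative barrier: the quadratic term keeps its sign under
  reflection and the cubic one changes it, whence the minus sign in \<open>le\<close>.\<close>

lemma exp_barrier_sub:
  assumes t: "t \<in> {0..T}" and R: "1 \<le> R"
    and le: "\<And>\<omega> p. \<omega> \<in> space M \<Longrightarrow> p \<in> off_diag \<Longrightarrow>
      - (rate * exp_barrier R t) \<le> quad t \<omega> p * (exp_barrier R t)^2 - cubic t \<omega> p * (exp_barrier R t)^3"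
  shows "- (3 * rate * exp_barrier R t) \<le> F_low t (- exp_barrier R t)"
proof (rule le_F_lowI[OF t])
  let ?B = "exp_barrier R t"
  have B: "1 \<le> ?B"
    using exp_barrier_ge[of R t] R t by linarith
  have "K \<le> rate"
    using K_pos by (simp add: rate_def)
  then have K: "K \<le> rate * ?B"
    using B K_pos mult_mono[of K rate 1 ?B] by simp
  fix \<omega> p assume \<omega>p: "\<omega> \<in> space M" "p \<in> off_diag"
  have "lin_coeff t \<omega> p * ?B \<le> rate * ?B"
    using coeff_bounds(2)[OF t \<omega>p] B by (intro mult_right_mono) (auto simp: rate_def)
  moreover have "- K \<le> dq1 (f t \<omega>) (fst p) (snd p)"
    using coeff_bounds(1)[OF t \<omega>p] by linarith
  moreover have "driver t (- ?B) \<omega> p = dq1 (f t \<omega>) (fst p) (snd p) - lin_coeff t \<omega> p * ?B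
      + (quad t \<omega> p * ?B^2 - cubic t \<omega> p * ?B^3)"
    unfolding driver_eq[OF t \<omega>p] by (simp add: power3_eq_cube)
  ultimately show "- (3 * rate * ?B) \<le> driver t (- ?B) \<omega> p"
    using le[OF \<omega>p] K by linarith
qed

section \<open>The three cases\<close>

lemma solutions_case_i:
  assumes "case_i M T b \<sigma> f"
  shows "(\<exists>y. bounded_backward_solution T (h_upper M g) F_up y) \<and>
    (\<exists>y. bounded_backward_solution T (h_lower M g) F_low y)"
proof -
  obtain \<epsilon> where \<epsilon>: "\<epsilon> > 0"
    and cubic: "\<And>t \<omega> p. t \<in> {0..T} \<Longrightarrow> \<omega> \<in> space M \<Longrightarrow> cubic t \<omega> p \<le> - \<epsilon> * \<bar>quad t \<omega> p\<bar>"
    using assms unfolding case_i_def by blast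
  \<comment> \<open>The 1 is for the barrier lemmas, \<open>K\<close> dominates the terminal values
    by \<open>h_bounds\<close>, and \<open>1 / \<epsilon>\<close> lets the cubic term win.\<close>
  define R where "R = max (max 1 K) (1 / \<epsilon>)"
  have R: "1 \<le> R" "K \<le> R" "1 / \<epsilon> \<le> R"
    by (auto simp: R_def)
  let ?B = "exp_barrier R"
  \<comment> \<open>With the absolute value, one estimate controls the nonlinear terms at both the
    upper and the lower barrier.\<close>
  have key: "\<bar>quad t \<omega> p\<bar> * (?B t)^2 + cubic t \<omega> p * (?B t)^3 \<le> 0"
    if "t \<in> {0..T}" "\<omega> \<in> space M" for t \<omega> p
  proof -
    have B: "0 \<le> ?B t" "1 / \<epsilon> \<le> ?B t"
      using exp_barrier_ge[of R t] R that by linarith+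
    have "cubic t \<omega> p * (?B t)^3 \<le> - \<epsilon> * \<bar>quad t \<omega> p\<bar> * (?B t)^3"
      using B by (intro mult_right_mono cubic that) auto
    \<comment> \<open>Since \<open>\<epsilon> * ?B t \<ge> 1\<close>, the quadratic term can be
      raised to third order, where the hypothesis on the cubic coefficient cancels it.\<close>
    moreover have "\<bar>quad t \<omega> p\<bar> * (?B t)^2 * 1 \<le> \<bar>quad t \<omega> p\<bar> * (?B t)^2 * (\<epsilon> * ?B t)"
      using B \<epsilon> by (intro mult_left_mono) (auto simp: field_simps)
    ultimately show ?thesis
      by (simp add: power2_eq_square power3_eq_cube ac_simps)
  qed
  show ?thesis
  proof (rule solutions_between_barriers)
    show "((\<lambda>s. - ?B s) has_real_derivative 3 * rate * ?B s) (at s within {0..T})" for s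
      using DERIV_minus[OF exp_barrier_deriv[of R s "{0..T}"]] by simp
    show "(?B has_real_derivative - (3 * rate * ?B s)) (at s within {0..T})" for s
      by (rule exp_barrier_deriv)
    fix s assume s: "s \<in> {0..T}"
    have B: "1 \<le> ?B s"
      using exp_barrier_ge[of R s] R s by linarith
    then have rB: "0 \<le> rate * ?B s"
      using rate_pos by simp
    show "- ?B s \<le> ?B s"
      using B by simp
    have quad: "quad s \<omega> p * (?B s)^2 \<le> \<bar>quad s \<omega> p\<bar> * (?B s)^2"
      "- (\<bar>quad s \<omega> p\<bar> * (?B s)^2) \<le> quad s \<omega> p * (?B s)^2" for \<omega> p
      using abs_ge_self[of "quad s \<omega> p * (?B s)^2"] abs_ge_minus_self[of "quad s \<omega> p * (?B s)^2"]
      unfolding abs_mult by simp_all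
    show "- (3 * rate * ?B s) \<le> F_low s (- ?B s)"
    proof (rule exp_barrier_sub[OF s R(1)])
      show "- (rate * ?B s) \<le> quad s \<omega> p * (?B s)^2 - cubic s \<omega> p * (?B s)^3" if "\<omega> \<in> space M" for \<omega> p
        using key[OF s that, of p] quad(2)[of \<omega> p] rB by linarith
    qed
    have "F_up s (?B s) \<le> 3 * rate * ?B s"
    proof (rule exp_barrier_super[OF s R(1)])
      show "quad s \<omega> p * (?B s)^2 + cubic s \<omega> p * (?B s)^3 \<le> rate * ?B s" if "\<omega> \<in> space M" for \<omega> p
        using key[OF s that, of p] quad(1)[of \<omega> p] rB by linarith
    qed
    then show "F_up s (?B s) \<le> - (- (3 * rate * ?B s))"
      by simp
  qed (use h_bounds R exp_barrier_terminal[of R] in linarith)+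
qed

text \<open>Small enough for the quadratic and cubic terms along \<open>exp_barrier (max 1 K)\<close> to be absorbed
  by the share of its growth reserved for them, on all of \<open>[0, T]\<close>.\<close>

definition max_coeff :: real where
  "max_coeff = rate / (2 * (max 1 K * exp (3 * rate * T))^2)"

text \<open>As \<open>v \<ge> 1\<close>, both terms are at most \<open>\<epsilon> * v^3\<close>, and
  \<open>max_coeff\<close> is chosen so that \<open>2 * \<epsilon> * v^2 \<le> rate\<close> up to
  the largest barrier value \<open>?E\<close>. Only upper bounds on \<open>q\<close> and
  \<open>c\<close> enter, so \<open>q\<close> may be \<open>quad\<close> or its negative.\<close>

lemma small_coeff_le:
  assumes "0 < \<epsilon>" "\<epsilon> \<le> max_coeff" "q \<le> \<epsilon>" "c \<le> \<epsilon>" "t \<in> {0..T}"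
  defines "v \<equiv> exp_barrier (max 1 K) t"
  shows "q * v^2 + c * v^3 \<le> rate * v"
proof -
  let ?E = "max 1 K * exp (3 * rate * T)"
  have "1 \<le> max 1 K" "0 \<le> max 1 K"
    by simp_all
  then have v: "1 \<le> v" "v \<le> ?E"
    unfolding v_def using exp_barrier_ge[OF _ assms(5)] exp_barrier_le[OF _ assms(5)] order_trans
    by blast+
  have "q * v^2 \<le> \<epsilon> * v^3"
  proof -
    have "q * v^2 \<le> \<epsilon> * v^2"
      using assms by (intro mult_right_mono) auto
    also have "\<dots> \<le> \<epsilon> * v^3"
      using v assms(1) by (intro mult_left_mono power_increasing) auto
    finally show ?thesis .
  qed
  moreover have "c * v^3 \<le> \<epsilon> * v^3"
    using assms v by (intro mult_right_mono) auto
  ultimately have "q * v^2 + c * v^3 \<le> (2 * \<epsilon> * v^2) * v"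
    by (simp add: power2_eq_square power3_eq_cube ac_simps)
  also have "\<dots> \<le> rate * v"
  proof (rule mult_right_mono)
    have "2 * \<epsilon> * v^2 \<le> 2 * max_coeff * ?E^2"
      using v assms(1,2) by (intro mult_mono power_mono) auto
    also have "\<dots> = rate"
      using K_pos by (simp add: max_coeff_def)
    finally show "2 * \<epsilon> * v^2 \<le> rate" .
  qed (use v in simp)
  finally show ?thesis .
qed

text \<open>Upper bounds on the quadratic and cubic coefficients limit the driver at large positive
  states only, so the exponential barrier is placed above. The constant \<open>l\<close> is a
  subsolution because its derivative is zero and \<open>F_low\<close> is nonnegative there.\<close>

lemma solutions_case_ii:
  assumes "0 < \<epsilon>" "\<epsilon> \<le> max_coeff" "case_ii M T b \<sigma> f g \<epsilon>"
  shows "(\<exists>y. bounded_backward_solution T (h_upper M g) F_up y) \<and>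
    (\<exists>y. bounded_backward_solution T (h_lower M g) F_low y)"
proof -
  obtain l where l: "l \<le> h_lower M g" "\<And>t. t \<in> {0..T} \<Longrightarrow> 0 \<le> F_low t l"
    and coeff: "\<And>t \<omega> p. t \<in> {0..T} \<Longrightarrow> \<omega> \<in> space M \<Longrightarrow> cubic t \<omega> p \<le> \<epsilon> \<and> quad t \<omega> p \<le> \<epsilon>"
    using assms(3) unfolding case_ii_def by blast
  let ?B = "exp_barrier (max 1 K)"
  show ?thesis
  proof (rule solutions_between_barriers)
    show "((\<lambda>s. l) has_real_derivative 0) (at s within {0..T})" for s
      by simp
    show "(?B has_real_derivative - (3 * rate * ?B s)) (at s within {0..T})" for s
      by (rule exp_barrier_deriv)
    fix s assume s: "s \<in> {0..T}"
    show "l \<le> ?B s"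
      using l(1) h_bounds exp_barrier_ge[of "max 1 K" s] s by linarith
    show "- 0 \<le> F_low s l"
      using l(2)[OF s] by simp
    have "F_up s (?B s) \<le> 3 * rate * ?B s"
      using coeff[OF s] small_coeff_le[OF assms(1,2) _ _ s]
      by (intro exp_barrier_super[OF s]) auto
    then show "F_up s (?B s) \<le> - (- (3 * rate * ?B s))"
      by simp
  qed (use l h_bounds exp_barrier_terminal[of "max 1 K"] in linarith)+
qed

lemma solutions_case_iii:
  assumes "0 < \<epsilon>" "\<epsilon> \<le> max_coeff" "case_iii M T b \<sigma> f g \<epsilon>"
  shows "(\<exists>y. bounded_backward_solution T (h_upper M g) F_up y) \<and>
    (\<exists>y. bounded_backward_solution T (h_lower M g) F_low y)"
proof -
  obtain l where l: "h_upper M g \<le> l" "\<And>t. t \<in> {0..T} \<Longrightarrow> F_up t l \<le> 0"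
    and coeff: "\<And>t \<omega> p. t \<in> {0..T} \<Longrightarrow> \<omega> \<in> space M \<Longrightarrow> cubic t \<omega> p \<le> \<epsilon> \<and> - \<epsilon> \<le> quad t \<omega> p"
    using assms(3) unfolding case_iii_def by blast
  let ?B = "exp_barrier (max 1 K)"
  show ?thesis
  proof (rule solutions_between_barriers)
    show "((\<lambda>s. - ?B s) has_real_derivative 3 * rate * ?B s) (at s within {0..T})" for s
      using DERIV_minus[OF exp_barrier_deriv[of "max 1 K" s "{0..T}"]] by simp
    show "((\<lambda>s. l) has_real_derivative 0) (at s within {0..T})" for s
      by simp
    fix s assume s: "s \<in> {0..T}"
    show "- ?B s \<le> l"
      using l(1) h_bounds exp_barrier_ge[of "max 1 K" s] s by linarith
    show "F_up s l \<le> - 0"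
      using l(2)[OF s] by simp
    show "- (3 * rate * ?B s) \<le> F_low s (- ?B s)"
    proof (rule exp_barrier_sub[OF s])
      \<comment> \<open>Reflecting the state turns \<open>quad\<close> into its negative and keeps
        \<open>cubic\<close>; the lower bound on \<open>quad\<close> is thus the upper bound that
        \<open>small_coeff_le\<close> needs.\<close>
      show "- (rate * ?B s) \<le> quad s \<omega> p * (?B s)^2 - cubic s \<omega> p * (?B s)^3" if "\<omega> \<in> space M" for \<omega> p
        using small_coeff_le[OF assms(1,2) _ _ s, of "- quad s \<omega> p" "cubic s \<omega> p"] coeff[OF s that, of p]
        by simp
    qed simp
  qed (use l h_bounds exp_barrier_terminal[of "max 1 K"] in linarith)+
qed

end

theorem theorem5p7:
  fixes T K\<^sub>0 :: real
  assumes "T > 0" and "K\<^sub>0 > 0"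
  shows "\<exists>\<epsilon>\<^sub>0>0. \<forall>(M :: 'a measure) B b \<sigma> f g.
    standard_brownian_motion M B \<longrightarrow>
    standing_assumption M B T K\<^sub>0 b \<sigma> f g \<longrightarrow>
    (\<forall>t\<in>{0..T}. \<forall>\<omega>\<in>space M. \<forall>x y z z'. \<sigma> t \<omega> (x, y, z) = \<sigma> t \<omega> (x, y, z')) \<longrightarrow>
    (case_i M T b \<sigma> f \<or>
     (\<exists>\<epsilon>. 0 < \<epsilon> \<and> \<epsilon> \<le> \<epsilon>\<^sub>0 \<and> case_ii M T b \<sigma> f g \<epsilon>) \<or>
     (\<exists>\<epsilon>. 0 < \<epsilon> \<and> \<epsilon> \<le> \<epsilon>\<^sub>0 \<and> case_iii M T b \<sigma> f g \<epsilon>)) \<longrightarrow>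
    (\<exists>y_upper. bounded_backward_solution T (h_upper M g) (F_upper M b \<sigma> f) y_upper) \<and>
    (\<exists>y_lower. bounded_backward_solution T (h_lower M g) (F_lower M b \<sigma> f) y_lower)"
proof -
  \<comment> \<open>This is \<open>max_coeff\<close> written out. It depends on \<open>T\<close> and
    \<open>K\<^sub>0\<close> alone, so the threshold can be fixed before the probability space and
    the coefficients are chosen.\<close>
  define \<epsilon>\<^sub>0 where
    "\<epsilon>\<^sub>0 = (2 * K\<^sub>0 + K\<^sub>0^2) / (2 * (max 1 K\<^sub>0 * exp (3 * (2 * K\<^sub>0 + K\<^sub>0^2) * T))^2)"
  have pos: "\<epsilon>\<^sub>0 > 0"
    unfolding \<epsilon>\<^sub>0_def using assms(2)
    by (intro divide_pos_pos mult_pos_pos zero_less_power add_pos_pos) auto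
  show ?thesis
  proof (rule exI[of _ \<epsilon>\<^sub>0], rule conjI[OF pos], intro allI impI)
    fix M :: "'a measure" and B b \<sigma> f g
    assume BM: "standard_brownian_motion M B"
      and standing: "standing_assumption M B T K\<^sub>0 b \<sigma> f g"
      and no_z: "\<forall>t\<in>{0..T}. \<forall>\<omega>\<in>space M. \<forall>x y z z'. \<sigma> t \<omega> (x, y, z) = \<sigma> t \<omega> (x, y, z')"
      and cases: "case_i M T b \<sigma> f \<or>
        (\<exists>\<epsilon>. 0 < \<epsilon> \<and> \<epsilon> \<le> \<epsilon>\<^sub>0 \<and> case_ii M T b \<sigma> f g \<epsilon>) \<or>
        (\<exists>\<epsilon>. 0 < \<epsilon> \<and> \<epsilon> \<le> \<epsilon>\<^sub>0 \<and> case_iii M T b \<sigma> f g \<epsilon>)"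
    have "prob_space M" "\<And>s. 0 \<le> s \<Longrightarrow> B s \<in> borel_measurable M"
      using BM unfolding standard_brownian_motion_def by blast+
    then interpret lipschitz_coefficients M B T K\<^sub>0 b \<sigma> f g
      using assms standing no_z
      by (auto simp: lipschitz_coefficients_def lipschitz_coefficients_axioms_def)
    have "max_coeff = \<epsilon>\<^sub>0"
      unfolding max_coeff_def rate_def \<epsilon>\<^sub>0_def ..
    then show "(\<exists>y_upper. bounded_backward_solution T (h_upper M g) (F_upper M b \<sigma> f) y_upper) \<and>
        (\<exists>y_lower. bounded_backward_solution T (h_lower M g) (F_lower M b \<sigma> f) y_lower)"
      using cases solutions_case_i solutions_case_ii solutions_case_iii by metis
  qed
qed

end
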